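(* Let $d\ge1$, and let $a=(a_1,\dots,a_d)$ and $b=(b_1,\dots,b_d)$ be nonincreasing tuples of dyadic numbers with $a\lesssim b$. Let $g\in SO(d)$ be distributed according to Haar measure. Then \[\mathbb{P}\Big[\big|g[a]\cap[b]\big|\sim|a|\Big]\sim I(a,b),\qquad I(a,b):=\prod_{i,j=1}^d\min(a_i^{-1}b_j,1).\]
   Context: For a nonincreasing dyadic tuple $s=(s_1,\dots,s_d)$, $[s]=[-\tfrac12 s_1,\tfrac12 s_1]\times\cdots\times[-\tfrac12 s_d,\tfrac12 s_d]$ and $|s|=\prod_i s_i$ (its volume). For tuples, $a\lesssim b$ means $a_i\le Cb_i$ for all $i$. All implied constants (in $\lesssim$, $\sim$, including the one defining the event $|g[a]\cap[b]|\sim|a|$) depend only on $d$. *)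

theory Defs
  imports "HOL-Probability.Probability"
begin

definition dyadic :: "real \<Rightarrow> bool" where
  "dyadic x \<longleftrightarrow> (\<exists>k::int. x = 2 powi k)"

text \<open>Tuples are indexed by a finite linearly ordered type 'n with d = CARD('n).\<close>
definition dyadic_tuple :: "real^'n \<Rightarrow> bool" where
  "dyadic_tuple s \<longleftrightarrow> (\<forall>i. dyadic (s $ i))"

definition nonincreasing_tuple :: "real^'n::{finite,linorder} \<Rightarrow> bool" where
  "nonincreasing_tuple s \<longleftrightarrow> (\<forall>i j. i \<le> j \<longrightarrow> s $ j \<le> s $ i)"

definition box_of :: "real^'n \<Rightarrow> (real^'n) set" where
  "box_of s = {x. \<forall>i. - (s $ i) / 2 \<le> x $ i \<and> x $ i \<le> s $ i / 2}"

definition tuple_vol :: "real^'n \<Rightarrow> real" where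
  "tuple_vol s = (\<Prod>i\<in>UNIV. s $ i)"

definition I_ab :: "real^'n \<Rightarrow> real^'n \<Rightarrow> real" where
  "I_ab a b = (\<Prod>i\<in>UNIV. \<Prod>j\<in>UNIV. min (b $ j / a $ i) 1)"

definition SO :: "(real^'n^'n) set" where
  "SO = {g. orthogonal_matrix g \<and> det g = 1}"

definition haar_SO :: "(real^'n^'n) measure \<Rightarrow> bool" where
  "haar_SO \<mu> \<longleftrightarrow> sets \<mu> = sets borel \<and> prob_space \<mu> \<and> emeasure \<mu> SO = 1 \<and>
     (\<forall>h\<in>SO. distr \<mu> borel (\<lambda>g. h ** g) = \<mu>)"

end

theory Submission
  imports Defs
begin

text \<open>
  If \<open>g[a] \<inter> [b]\<close> has volume at least \<open>c|a|\<close>, then the slab \<open>{x \<in> [a]. 2|(gx)\<^sub>j| \<le> b\<^sub>j}\<close> does too,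
  which forces \<open>|g\<^sub>j\<^sub>i| \<le> c\<^sup>-\<^sup>1 b\<^sub>j/a\<^sub>i\<close> for all \<open>i, j\<close>; conversely these entry bounds place a fixed
  multiple of \<open>g[a]\<close> inside \<open>[b]\<close>. So one has to estimate the Haar measure of
  \<open>X = {g. \<forall>i j. |g\<^sub>j\<^sub>i| \<le> A b\<^sub>j/a\<^sub>i}\<close>.

  Haar measure is compared with Lebesgue measure on all matrices, which is invariant under
  \<open>M \<mapsto> Mg\<close>: by Fubini, averaging \<open>\<mu>{g. Mg \<in> W}\<close> over \<open>M \<in> B\<close> amounts to averaging
  \<open>|B \<inter> Wg\<^sup>-\<^sup>1|\<close> over \<open>g\<close>. Writing \<open>M = RQ\<close> with \<open>R\<close> upper triangular and \<open>Q\<close> a rotation,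
  left invariance gives \<open>\<mu>{g. Mg \<in> W} = \<mu>{g. Rg \<in> W}\<close>. As \<open>b\<close> is nonincreasing,
  multiplication by a bounded upper triangular matrix preserves the conditions \<open>|N\<^sub>j\<^sub>i| \<lesssim> min(b\<^sub>j/a\<^sub>i, 1)\<close>, so \<open>X\<close> and the box
  \<open>W\<close> cut out by them control each other, and \<open>|W|\<close> is comparable to \<open>I(a,b)\<close>.
\<close>

section \<open>Lebesgue measure under linear maps\<close>

text \<open>
  The linear change of variables in HOL-Analysis asks for an index type of class wellorder.
  A finite linear order is not recognised as such by the type classes, hence the wrapper.
\<close>

datatype 'a wellordered_index = Index (the_index: 'a)

instance wellordered_index :: (finite) finite
proof
  have "UNIV = range (Index :: 'a \<Rightarrow> _)"
    by (metis UNIV_eq_I rangeI wellordered_index.exhaust_sel)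
  then show "finite (UNIV :: 'a wellordered_index set)"
    by (metis finite finite_imageI)
qed

instantiation wellordered_index :: ("{finite,linorder}") wellorder
begin

definition less_eq_wellordered_index :: "'a wellordered_index \<Rightarrow> 'a wellordered_index \<Rightarrow> bool" where
  "less_eq_wellordered_index i j \<longleftrightarrow> the_index i \<le> the_index j"

definition less_wellordered_index :: "'a wellordered_index \<Rightarrow> 'a wellordered_index \<Rightarrow> bool" where
  "less_wellordered_index i j \<longleftrightarrow> the_index i < the_index j"

instance
proof
  fix P :: "'a wellordered_index \<Rightarrow> bool" and i
  assume step: "\<And>x. (\<And>y. y < x \<Longrightarrow> P y) \<Longrightarrow> P x"
  \<comment> \<open>On a finite type well-foundedness reduces to acyclicity, which holds because the
    number of strictly larger indices drops along \<open><\<close>.\<close>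
  have "wf {(x :: 'a wellordered_index, y). x < y}"
    by (rule finite_acyclic_wf)
       (auto intro!: acyclicI_order[where f = "\<lambda>i. card {j. j > the_index i}"] psubset_card_mono
         simp: less_wellordered_index_def)
  then show "P i"
    by (rule wf_induct_rule) (auto intro: step)
qed (auto simp: less_eq_wellordered_index_def less_wellordered_index_def wellordered_index.expand)

end

lemma bij_the_index: "bij the_index"
  by (metis bijI' wellordered_index.expand wellordered_index.sel)

lemma prod_Basis_cart:
  fixes x :: "real^'n"
  shows "(\<Prod>b\<in>Basis. x \<bullet> b) = (\<Prod>i\<in>UNIV. x $ i)"
proof -
  have "Basis = range (\<lambda>i::'n. axis i (1::real))"
    by (auto simp: Basis_vec_def)
  moreover have "inj (\<lambda>i::'n. axis i (1::real))"
    by (auto simp: inj_on_def axis_eq_axis)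
  then have "prod ((\<bullet>) x) (range (\<lambda>i::'n. axis i (1::real))) = (\<Prod>i\<in>UNIV. x $ i)"
    by (subst prod.reindex) (simp_all add: inner_axis)
  ultimately show ?thesis by simp
qed

lemma borel_measurable_linear:
  fixes f :: "'a::euclidean_space \<Rightarrow> 'b::euclidean_space"
  assumes "linear f"
  shows "f \<in> borel_measurable borel"
  using assms by (simp add: borel_measurable_continuous_onI linear_continuous_on linear_conv_bounded_linear)

lemma linear_reindex: "linear (\<lambda>x::real^'n. \<chi> i::'m::finite. x $ h i)"
  by (auto intro!: linearI simp: vec_eq_iff)

text \<open>The preimage of a box is a box with the same side lengths in another order. This carries
  Lebesgue measure between \<open>'n\<close> and \<open>'n wellordered_index\<close>.\<close>

lemma distr_lborel_reindex:
  fixes h :: "'m::finite \<Rightarrow> 'n::finite"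
  assumes h: "bij h"
  shows "distr lborel borel (\<lambda>x::real^'n. \<chi> i. x $ h i) = lborel"
proof (rule lborel_eqI[symmetric])
  let ?f = "\<lambda>x::real^'n. \<chi> i. x $ h i"
  fix l u :: "real^'m" assume lu: "\<And>b. b \<in> Basis \<Longrightarrow> l \<bullet> b \<le> u \<bullet> b"
  let ?l = "\<chi> j. l $ inv h j" and ?u = "\<chi> j. u $ inv h j"
  have le: "l $ i \<le> u $ i" for i
    using lu[of "axis i 1"] by (simp add: inner_axis axis_in_Basis_iff)
  have inv: "h (inv h j) = j" "inv h (h i) = i" for i j
    using h by (simp_all add: bij_is_inj bij_is_surj surj_f_inv_f)
  have box: "?f -` box l u = box ?l ?u"
    by (auto simp: mem_box_cart) (metis inv)+
  have "emeasure lborel (box ?l ?u) = (\<Prod>b\<in>Basis. (?u - ?l) \<bullet> b)"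
    by (rule emeasure_lborel_box) (auto simp: Basis_vec_def inner_axis le)
  also have "\<dots> = ennreal (\<Prod>j\<in>UNIV. u $ inv h j - l $ inv h j)"
    by (subst prod_Basis_cart) simp
  also have "\<dots> = ennreal (\<Prod>i\<in>UNIV. u $ i - l $ i)"
    using prod.reindex_bij_betw[OF bij_imp_bij_inv[OF h], of "\<lambda>i. u $ i - l $ i"] by simp
  finally show "emeasure (distr lborel borel ?f) (box l u) = (\<Prod>b\<in>Basis. (u - l) \<bullet> b)"
    by (simp add: emeasure_distr borel_measurable_linear[OF linear_reindex] box prod_Basis_cart del: prod_ennreal)
qed simp

text \<open>It is enough to compare boxes. The preimage of a box is its image under the inverse,
  which is again orthogonal, so \<open>measure_orthogonal_image\<close> gives its volume.\<close>

lemma distr_lborel_orthogonal_transformation_wellorder: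
  fixes f :: "real^'n::{finite,wellorder} \<Rightarrow> real^'n::_"
  assumes f: "orthogonal_transformation f"
  shows "distr lborel borel f = lborel"
proof (rule lborel_eqI[symmetric])
  have lin: "linear f" and bij: "bij f"
    using f by (auto simp: orthogonal_transformation_linear orthogonal_transformation_bij)
  note meas = borel_measurable_linear[OF lin]
  fix l u :: "real^'n::_" assume lu: "\<And>b. b \<in> Basis \<Longrightarrow> l \<bullet> b \<le> u \<bullet> b"
  have inv: "orthogonal_transformation (inv f)"
    using f by (rule orthogonal_transformation_inv)
  have eq: "f -` box l u = inv f ` box l u"
    using bij by (simp add: bij_vimage_eq_inv_image)
  have borel: "f -` box l u \<in> sets lborel"
    using measurable_sets[OF meas, of "box l u"] by simp
  have fin: "f -` box l u \<in> lmeasurable"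
    unfolding eq by (rule measurable_orthogonal_image[OF inv]) simp
  have "emeasure lborel (f -` box l u) = emeasure lebesgue (f -` box l u)"
    using borel by simp
  also have "\<dots> = ennreal (measure lebesgue (f -` box l u))"
    using fin by (simp add: emeasure_eq_measure2 fmeasurableD2)
  also have "\<dots> = ennreal (measure lebesgue (box l u))"
    unfolding eq by (subst measure_orthogonal_image[OF inv]) simp_all
  finally show "emeasure (distr lborel borel f) (box l u) = (\<Prod>b\<in>Basis. (u - l) \<bullet> b)"
    using lu by (subst emeasure_distr) (simp_all add: meas measure_lborel_box_eq)
qed simp

text \<open>Relabelling coordinates preserves inner products and Lebesgue measure, so
  \<open>f\<close> is conjugated to the wellordered case and the three pushforwards are
  composed.\<close>

lemma distr_lborel_orthogonal_transformation:
  fixes f :: "real^'n::{finite,linorder} \<Rightarrow> real^'n::_"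
  assumes f: "orthogonal_transformation f"
  shows "distr lborel borel f = lborel"
proof -
  let ?r = "\<lambda>x::real^'n::_. \<chi> i. x $ the_index i"
  let ?s = "\<lambda>x::real^('n::_ wellordered_index). \<chi> i. x $ Index i"
  have bij_Index: "bij (Index :: 'n \<Rightarrow> _)"
    by (metis bijI' wellordered_index.exhaust wellordered_index.inject)
  have inner_s: "?s x \<bullet> ?s y = x \<bullet> y" for x y
    using sum.reindex_bij_betw[OF bij_Index, of "\<lambda>i. x $ i * y $ i"] by (simp add: inner_vec_def)
  have inner_r: "?r x \<bullet> ?r y = x \<bullet> y" for x y
    using sum.reindex_bij_betw[OF bij_the_index, of "\<lambda>i. x $ i * y $ i"] by (simp add: inner_vec_def)
  let ?F = "\<lambda>x. ?r (f (?s x))"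
  have lin_f: "linear f" using f by (rule orthogonal_transformation_linear)
  have "linear ?F"
    using linear_compose[OF linear_compose[OF linear_reindex lin_f] linear_reindex]
    by (simp add: o_def)
  then have "orthogonal_transformation ?F"
    using f by (simp add: orthogonal_transformation_def inner_s inner_r del: vec_lambda_beta)
  then have F: "distr lborel borel ?F = lborel"
    by (rule distr_lborel_orthogonal_transformation_wellorder)
  have m: "f \<in> borel_measurable borel" "?r \<in> borel_measurable borel" "?s \<in> borel_measurable borel"
     "?F \<in> borel_measurable borel"
    by (rule borel_measurable_linear, fact)
       (rule borel_measurable_linear, rule linear_reindex,
        rule borel_measurable_linear, rule linear_reindex,
        rule borel_measurable_linear, fact)
  have "lborel = distr (distr (distr lborel borel ?r) borel ?F) borel ?s"
    by (simp add: distr_lborel_reindex[OF bij_the_index] F distr_lborel_reindex[OF bij_Index])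
  also have "\<dots> = distr lborel borel (?s \<circ> ?F \<circ> ?r)"
    using m by (simp add: distr_distr o_assoc cong: distr_cong)
  also have "?s \<circ> ?F \<circ> ?r = f"
    by (auto simp: fun_eq_iff vec_eq_iff)
  finally show ?thesis by simp
qed

section \<open>Lebesgue measure on matrices\<close>

text \<open>A product over rows: right multiplication acts on each row separately, so its effect on
  this measure can be read off from Lebesgue measure on vectors.\<close>

definition lebesgue_matrix :: "(real^'n^'m) measure" where
  "lebesgue_matrix = distr (Pi\<^sub>M UNIV (\<lambda>_. lborel)) borel (\<lambda>\<omega>. \<chi> i. \<omega> i)"

lemma sets_lebesgue_matrix [simp, measurable_cong]: "sets lebesgue_matrix = sets borel"
  by (simp add: lebesgue_matrix_def)

lemma space_lebesgue_matrix [simp]: "space lebesgue_matrix = UNIV"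
  by (simp add: lebesgue_matrix_def)

lemma measurable_vec_lambda_PiM:
  "(\<lambda>\<omega>. \<chi> i. \<omega> i) \<in> borel_measurable (Pi\<^sub>M UNIV (\<lambda>_::'m::finite. lborel :: (real^'n) measure))"
proof (subst borel_measurable_euclidean_space, intro ballI)
  fix b :: "real^'n^'m" assume "b \<in> Basis"
  then obtain i u where b: "b = axis i u" by (auto simp: Basis_vec_def)
  have "(\<lambda>\<omega>. \<omega> i \<bullet> u) \<in> borel_measurable (Pi\<^sub>M UNIV (\<lambda>_::'m. lborel :: (real^'n) measure))"
    by measurable
  then show "(\<lambda>\<omega>. (\<chi> i. \<omega> i) \<bullet> b) \<in> borel_measurable (Pi\<^sub>M UNIV (\<lambda>_::'m. lborel :: (real^'n) measure))"
    by (simp add: b inner_axis)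
qed

lemma emeasure_lebesgue_matrix:
  assumes "X \<in> sets borel"
  shows "emeasure (lebesgue_matrix :: (real^'n^'m) measure) X
    = emeasure (Pi\<^sub>M UNIV (\<lambda>_. lborel)) {\<omega>. (\<chi> i. \<omega> i) \<in> X}"
  unfolding lebesgue_matrix_def
  by (subst emeasure_distr[OF measurable_vec_lambda_PiM])
     (use assms in \<open>auto simp: space_PiM PiE_UNIV_domain vimage_def\<close>)

lemma closed_entry_bounds:
  "closed {M :: real^'n^'m. \<forall>i j. l i j \<le> M $ i $ j \<and> M $ i $ j \<le> u i j}"
  by (intro closed_Collect_all closed_Collect_conj closed_Collect_le continuous_intros)

lemma emeasure_lebesgue_matrix_entry_bounds:
  assumes "\<And>i j. l i j \<le> u i j"
  shows "emeasure lebesgue_matrix {M :: real^'n^'m. \<forall>i j. l i j \<le> M $ i $ j \<and> M $ i $ j \<le> u i j}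
    = ennreal (\<Prod>i\<in>UNIV. \<Prod>j\<in>UNIV. u i j - l i j)"
proof -
  interpret product_sigma_finite "\<lambda>_::'m. lborel :: (real^'n) measure"
    by standard
  let ?X = "{M :: real^'n^'m. \<forall>i j. l i j \<le> M $ i $ j \<and> M $ i $ j \<le> u i j}"
  let ?C = "\<lambda>i. cbox (\<chi> j. l i j) (\<chi> j. u i j) :: (real^'n) set"
  have "{\<omega>. (\<chi> i. \<omega> i) \<in> ?X} = Pi\<^sub>E UNIV ?C"
    by (auto simp: PiE_UNIV_domain mem_box_cart Pi_def)
  moreover have "emeasure lborel (?C i) = ennreal (\<Prod>j\<in>UNIV. u i j - l i j)" for i
  proof -
    have "?C i \<noteq> {}"
      using assms by (simp add: interval_ne_empty_cart)
    then show ?thesis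
      using emeasure_eq_ennreal_measure[of lborel "?C i"]
        emeasure_lborel_cbox_finite[of "\<chi> j. l i j" "\<chi> j. u i j"]
      by (simp add: content_cbox_cart)
  qed
  ultimately show ?thesis
    using assms closed_entry_bounds[of l u]
    by (simp add: emeasure_lebesgue_matrix emeasure_PiM prod_ennreal prod_nonneg)
qed

text \<open>Needed for Fubini; the cubes of matrices with entries in [-n, n] exhaust the
  space.\<close>

lemma sigma_finite_lebesgue_matrix: "sigma_finite_measure (lebesgue_matrix :: (real^'n^'m) measure)"
proof
  define X where "X n = {M :: real^'n^'m. \<forall>i j. - real n \<le> M $ i $ j \<and> M $ i $ j \<le> real n}" for n
  have X: "emeasure lebesgue_matrix (X n) \<noteq> \<infinity>" for n
    unfolding X_def by (subst emeasure_lebesgue_matrix_entry_bounds) simp_all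
  have "closed (X n)" for n
    unfolding X_def by (rule closed_entry_bounds)
  moreover have "(\<Union>n. X n) = UNIV"
  proof safe
    fix M :: "real^'n^'m"
    obtain n where n: "norm M \<le> real n" using real_arch_simple by blast
    have "\<bar>M $ i $ j\<bar> \<le> real n" for i j
      using component_le_norm_cart[of "M $ i" j] Finite_Cartesian_Product.norm_nth_le[of M i] n by linarith
    then have "M \<in> X n" by (auto simp: X_def abs_le_iff minus_le_iff)
    then show "M \<in> (\<Union>n. X n)" by blast
  qed simp
  ultimately show "\<exists>A. countable A \<and> A \<subseteq> sets (lebesgue_matrix :: (real^'n^'m) measure) \<and>
      \<Union>A = space lebesgue_matrix \<and> (\<forall>a\<in>A. emeasure lebesgue_matrix a \<noteq> \<infinity>)"
    using X by (intro exI[of _ "range X"]) auto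
qed

lemma borel_measurable_matrix_mult_left [measurable]:
  "(\<lambda>M::real^'n^'m. M ** (g :: real^'k^'n)) \<in> borel_measurable borel"
  unfolding matrix_matrix_mult_def by (intro borel_measurable_continuous_onI continuous_intros)

text \<open>Each row of \<open>M ** g\<close> is a row of \<open>M\<close> under a fixed orthogonal
  map. The row measures are preserved, hence so is their product. This is the right invariance
  behind the averaging argument.\<close>

lemma emeasure_lebesgue_matrix_mult_orthogonal:
  fixes g :: "real^'n::{finite,linorder}^'n::_" and X :: "((real^'n::_)^'m) set"
  assumes g: "orthogonal_matrix g" and X: "X \<in> sets borel"
  shows "emeasure lebesgue_matrix {M. M ** g \<in> X} = emeasure lebesgue_matrix X"
proof -
  interpret product_sigma_finite "\<lambda>_::'m. lborel :: (real^'n::_) measure"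
    by standard
  let ?P = "Pi\<^sub>M UNIV (\<lambda>_::'m. lborel :: (real^'n::_) measure)"
  let ?f = "\<lambda>x::real^'n::_. x v* g" and ?F = "\<lambda>\<omega> (i::'m). (\<omega> i :: real^'n::_) v* g"
  have f_eq: "?f = (\<lambda>x. transpose g *v x)"
    by (simp add: fun_eq_iff)
  have "orthogonal_transformation ?f"
    unfolding f_eq using g
    by (simp add: orthogonal_matrix_transpose orthogonal_transformation_matrix)
  then have distr: "distr lborel borel ?f = lborel"
    by (rule distr_lborel_orthogonal_transformation)
  have meas_f: "?f \<in> lborel \<rightarrow>\<^sub>M lborel"
    unfolding f_eq
    by (simp only: measurable_lborel1 measurable_lborel2)
       (rule borel_measurable_linear, rule matrix_vector_mul_linear)
  have meas_F: "?F \<in> ?P \<rightarrow>\<^sub>M ?P"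
    by (intro measurable_PiM_single') (use meas_f in \<open>auto intro: measurable_compose[OF _ meas_f]\<close>)
  have PF: "distr ?P ?P ?F = ?P"
  proof (rule PiM_eqI)
    fix A :: "'m \<Rightarrow> (real^'n::_) set"
    assume A: "\<And>i. i \<in> UNIV \<Longrightarrow> A i \<in> sets lborel"
    have "?F -` (Pi\<^sub>E UNIV A) \<inter> space ?P = Pi\<^sub>E UNIV (\<lambda>i. ?f -` A i)"
      by (auto simp: space_PiM PiE_UNIV_domain)
    moreover have "emeasure lborel (?f -` A i) = emeasure lborel (A i)" for i
    proof -
      have "emeasure (distr lborel borel ?f) (A i) = emeasure lborel (?f -` A i)"
        using A[of i] meas_f by (subst emeasure_distr) simp_all
      then show ?thesis by (simp add: distr)
    qed
    moreover have "?f -` A i \<in> sets lborel" for i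
      using measurable_sets[OF meas_f, of "A i"] A by simp
    ultimately show "emeasure (distr ?P ?P ?F) (Pi\<^sub>E UNIV A) = (\<Prod>i\<in>UNIV. emeasure lborel (A i))"
      using A by (subst emeasure_distr[OF meas_F]) (simp_all add: emeasure_PiM sets_PiM_I_finite)
  qed simp_all
  have X': "{M. M ** g \<in> X} \<in> sets borel"
    using measurable_sets[OF borel_measurable_matrix_mult_left X] by (simp add: vimage_def)
  have S: "{\<omega>. (\<chi> i. \<omega> i) \<in> X} \<in> sets ?P"
    using measurable_sets[OF measurable_vec_lambda_PiM X]
    by (simp add: vimage_def space_PiM PiE_UNIV_domain)
  have mult: "(\<chi> i. \<omega> i) ** g = (\<chi> i. ?F \<omega> i)" for \<omega> :: "'m \<Rightarrow> real^'n::_"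
    by (simp add: matrix_matrix_mult_def vector_matrix_mult_def vec_eq_iff mult.commute)
  have "emeasure lebesgue_matrix {M. M ** g \<in> X} = emeasure ?P (?F -` {\<omega>. (\<chi> i. \<omega> i) \<in> X} \<inter> space ?P)"
    by (subst emeasure_lebesgue_matrix[OF X'])
       (simp add: mult vimage_def space_PiM PiE_UNIV_domain)
  also have "\<dots> = emeasure (distr ?P ?P ?F) {\<omega>. (\<chi> i. \<omega> i) \<in> X}"
    by (rule emeasure_distr[OF meas_F S, symmetric])
  also have "\<dots> = emeasure lebesgue_matrix X"
    by (simp add: PF emeasure_lebesgue_matrix[OF X])
  finally show ?thesis .
qed

section \<open>Triangular decomposition\<close>

text \<open>The combinations form a subspace containing the generators, so minimality of the span
  applies. Coefficients are indexed by \<open>A\<close> rather than by vectors, so that they can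
  serve as matrix entries.\<close>

lemma span_image_finite_obtain:
  fixes f :: "'i \<Rightarrow> 'a::real_vector"
  assumes "finite A" "y \<in> span (f ` A)"
  obtains u where "y = (\<Sum>k\<in>A. u k *\<^sub>R f k)"
proof -
  let ?V = "range (\<lambda>u. \<Sum>k\<in>A. u k *\<^sub>R f k)"
  have "subspace ?V"
  proof (rule subspaceI)
    show "0 \<in> ?V" by (rule range_eqI[of _ _ "\<lambda>_. 0"]) simp
    show "x + y \<in> ?V" if "x \<in> ?V" "y \<in> ?V" for x y
    proof -
      from that obtain u v where "x = (\<Sum>k\<in>A. u k *\<^sub>R f k)" "y = (\<Sum>k\<in>A. v k *\<^sub>R f k)" by blast
      then have "x + y = (\<Sum>k\<in>A. (u k + v k) *\<^sub>R f k)"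
        by (simp add: scaleR_add_left sum.distrib)
      then show ?thesis by (rule range_eqI[of _ _ "\<lambda>k. u k + v k"])
    qed
    show "c *\<^sub>R x \<in> ?V" if "x \<in> ?V" for c x
    proof -
      from that obtain u where "x = (\<Sum>k\<in>A. u k *\<^sub>R f k)" by blast
      then have "c *\<^sub>R x = (\<Sum>k\<in>A. (c * u k) *\<^sub>R f k)"
        by (simp add: scaleR_sum_right)
      then show ?thesis by (rule range_eqI[of _ _ "\<lambda>k. c * u k"])
    qed
  qed
  moreover have "f ` A \<subseteq> ?V"
  proof safe
    fix k assume "k \<in> A"
    then have "f k = (\<Sum>l\<in>A. (if l = k then 1 else 0) *\<^sub>R f l)"
      using assms(1) by (simp add: if_distrib[of "\<lambda>c. c *\<^sub>R _"] cong: if_cong)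
    then show "f k \<in> ?V" by (rule range_eqI[of _ _ "\<lambda>l. if l = k then 1 else 0"])
  qed
  ultimately show ?thesis
    using span_minimal assms(2) that by blast
qed

lemma matrix_mult_transpose_nth: "(A ** transpose B) $ i $ j = A $ i \<bullet> (B $ j :: real^'n)"
  by (simp add: matrix_matrix_mult_def transpose_def inner_vec_def)

text \<open>Gram--Schmidt on the rows, starting from the last one.\<close>

lemma upper_triangular_orthogonal_decomposition:
  fixes M :: "real^'n::{finite,linorder}^'n::_"
  assumes "invertible M"
  obtains Q R S :: "real^'n::_^'n::_" where
    "Q \<in> SO" "M = R ** Q" "S ** R = mat 1"
    "\<And>i j. j < i \<Longrightarrow> R $ i $ j = 0" "\<And>i j. j < i \<Longrightarrow> S $ i $ j = 0"
proof -
  have "\<exists>u. \<forall>w\<in>span (($) M ` {i<..}). orthogonal (M $ i - (\<Sum>k\<in>{i<..}. u k *\<^sub>R M $ k)) w" for i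
  proof -
    obtain y z where y: "y \<in> span (($) M ` {i<..})"
      and z: "\<And>w. w \<in> span (($) M ` {i<..}) \<Longrightarrow> orthogonal z w" and "M $ i = y + z"
      using orthogonal_subspace_decomp_exists by blast
    obtain u where "y = (\<Sum>k\<in>{i<..}. u k *\<^sub>R M $ k)"
      using span_image_finite_obtain[OF _ y] by auto
    with \<open>M $ i = y + z\<close> z have "\<forall>w\<in>span (($) M ` {i<..}). orthogonal (M $ i - (\<Sum>k\<in>{i<..}. u k *\<^sub>R M $ k)) w"
      by simp
    then show ?thesis by blast
  qed
  then obtain u where u: "\<And>i w. w \<in> span (($) M ` {i<..}) \<Longrightarrow>
      orthogonal (M $ i - (\<Sum>k\<in>{i<..}. u i k *\<^sub>R M $ k)) w"
    by metis
  \<comment> \<open>\<open>T\<close> is the unitriangular matrix of Gram--Schmidt coefficients: the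
    rows of \<open>T ** M\<close> are the orthogonalised rows of \<open>M\<close>.\<close>
  define T :: "real^'n::_^'n::_" where "T = (\<chi> i k. if k = i then 1 else if i < k then - u i k else 0)"
  define Z where "Z = T ** M"
  have Z: "Z $ i = M $ i - (\<Sum>k\<in>{i<..}. u i k *\<^sub>R M $ k)" for i
  proof -
    have "Z $ i = (\<Sum>k\<in>UNIV. T $ i $ k *\<^sub>R M $ k)"
      by (simp add: Z_def matrix_matrix_mult_def vec_eq_iff)
    also have "\<dots> = (\<Sum>k\<in>insert i {i<..}. T $ i $ k *\<^sub>R M $ k)"
      by (rule sum.mono_neutral_right) (auto simp: T_def)
    also have "\<dots> = M $ i - (\<Sum>k\<in>{i<..}. u i k *\<^sub>R M $ k)"
      by (simp add: T_def sum_negf flip: scaleR_minus_left)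
         (auto simp: T_def sum_negf[symmetric] intro!: sum.cong)
    finally show ?thesis .
  qed
  have Z_orth: "Z $ i \<bullet> M $ k = 0" if "i < k" for i k
    using u[of "M $ k" i] that by (auto simp: Z orthogonal_def intro: span_base)
  have Z_orth_Z: "Z $ i \<bullet> Z $ k = 0" if "i < k" for i k
    using that by (subst (2) Z) (auto simp: inner_diff_right inner_sum_right Z_orth)
  \<comment> \<open>A vanishing row of \<open>Z\<close> would be a linear dependence between the
    rows of the invertible \<open>M\<close>, although its coefficient \<open>T $ i $ i\<close> is
    1.\<close>
  have Z_nz: "Z $ i \<noteq> 0" for i
  proof
    assume "Z $ i = 0"
    then have "(\<Sum>k\<in>UNIV. T $ i $ k *s row k M) = 0"
      by (simp add: Z_def matrix_matrix_mult_def vec_eq_iff row_def)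
    moreover obtain N where "M ** N = mat 1" using assms by (auto simp: invertible_def)
    ultimately have "T $ i $ i = 0"
      using matrix_right_invertible_independent_rows[of M] by blast
    then show False by (simp add: T_def)
  qed
  define Q0 :: "real^'n::_^'n::_" where "Q0 = (\<chi> i. Z $ i /\<^sub>R norm (Z $ i))"
  have Q0: "orthogonal_matrix Q0"
    unfolding orthogonal_matrix_orthonormal_rows
  proof (intro conjI allI impI)
    show "norm (row i Q0) = 1" for i
    proof -
      have "row i Q0 = Z $ i /\<^sub>R norm (Z $ i)" by (simp add: row_def Q0_def vec_eq_iff)
      then show ?thesis using Z_nz[of i] by simp
    qed
    show "orthogonal (row i Q0) (row j Q0)" if "i \<noteq> j" for i j
    proof -
      have "Z $ i \<bullet> Z $ j = 0"
        using that Z_orth_Z[of i j] Z_orth_Z[of j i] by (metis inner_commute linorder_neqE)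
      moreover have "row i Q0 = Z $ i /\<^sub>R norm (Z $ i)" for i by (simp add: row_def Q0_def vec_eq_iff)
      ultimately show ?thesis by (simp add: orthogonal_def)
    qed
  qed
  \<comment> \<open>Any index will do: row \<open>p\<close> is multiplied by \<open>det Q0\<close>,
    which is 1 or -1, so that the resulting orthogonal matrix has determinant 1.\<close>
  obtain p :: 'n where True by simp
  define s where "s = det Q0"
  have s: "s = 1 \<or> s = -1" using det_orthogonal_matrix[OF Q0] by (simp add: s_def)
  define c where "c i = (if i = p then s else 1) / norm (Z $ i)" for i
  define D :: "real^'n::_^'n::_" where "D = (\<chi> i j. if i = j then if i = p then s else 1 else 0)"
  define Q where "Q = D ** Q0"
  define S :: "real^'n::_^'n::_" where "S = (\<chi> i j. c i * T $ i $ j)"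
  have Qn: "Q $ i = c i *\<^sub>R Z $ i" for i
    by (simp add: Q_def D_def Q0_def c_def matrix_matrix_mult_def vec_eq_iff if_distrib[of "\<lambda>c. c * _"]
        divide_inverse cong: if_cong)
  have "det D = (\<Prod>i\<in>UNIV. if i = p then s else 1)"
    by (subst det_diagonal) (simp_all add: D_def)
  then have "det D = s" by simp
  moreover have "orthogonal_matrix D"
    using s unfolding orthogonal_matrix
    by (auto simp: D_def matrix_matrix_mult_def transpose_def mat_def vec_eq_iff if_distrib[of "\<lambda>c. c * _"]
        cong: if_cong)
  ultimately have Q: "Q \<in> SO"
    using Q0 s by (auto simp: SO_def Q_def orthogonal_matrix_mul det_mul s_def)
  then have Qt: "transpose Q ** Q = mat 1" "Q ** transpose Q = mat 1"
    by (auto simp: SO_def orthogonal_matrix_def)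
  have SM: "S ** M = Q"
    by (simp add: vec_eq_iff Qn S_def Z_def matrix_matrix_mult_def sum_distrib_left mult.assoc)
  show ?thesis
  proof
    show "Q \<in> SO" by fact
    \<comment> \<open>\<open>R\<close> is \<open>M ** transpose Q\<close>; its entry (i, j) is a
      multiple of \<open>M $ i \<bullet> Z $ j\<close> and so vanishes for j < i. \<open>S\<close>
      is \<open>T\<close> with rescaled rows, and \<open>S ** M = Q\<close> makes it a left inverse
      of \<open>R\<close>.\<close>
    show "M = (M ** transpose Q) ** Q"
      by (simp add: Qt flip: matrix_mul_assoc)
    show "S ** (M ** transpose Q) = mat 1"
      by (simp add: matrix_mul_assoc SM Qt)
    show "(M ** transpose Q) $ i $ j = 0" if "j < i" for i j
      using Z_orth[OF that] by (simp add: matrix_mult_transpose_nth Qn inner_commute)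
    show "S $ i $ j = 0" if "j < i" for i j
      using that by (auto simp: S_def T_def)
  qed
qed

section \<open>Norm and entry estimates for matrices\<close>

lemma orthogonal_matrix_row_norm: "orthogonal_matrix (g::real^'n^'n) \<Longrightarrow> norm (g $ i) = 1"
  by (metis orthogonal_matrix_orthonormal_rows row_def vec_nth_inverse)

lemma orthogonal_matrix_entry_le:
  fixes g :: "real^'n^'n"
  assumes "orthogonal_matrix g"
  shows "\<bar>g $ i $ j\<bar> \<le> 1"
  using component_le_norm_cart[of "g $ i" j] orthogonal_matrix_row_norm[OF assms, of i] by simp

lemma norm_orthogonal_matrix_vector_mult:
  fixes g :: "real^'n^'n"
  assumes "orthogonal_matrix g"
  shows "norm (g *v x) = norm x"
  using assms by (metis matrix_of_matrix_vector_mul matrix_vector_mul_linear orthogonal_transformation_matrix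
      orthogonal_transformation_norm)

text \<open>At a coordinate \<open>i\<close> where \<open>x\<close> is largest in modulus, the
  diagonal term is at least \<kappa>/2 times \<open>\<bar>x $ i\<bar>\<close> and the other terms
  add up to at most \<kappa>/4 times it, while \<open>norm x\<close> is at most
  \<open>CARD('n)\<close> times it.\<close>

lemma diagonally_dominant_norm_ge:
  fixes N :: "real^'n^'n" and \<kappa> :: real
  assumes diag: "\<And>i. \<kappa> / 2 \<le> N $ i $ i"
    and off: "\<And>i j. i \<noteq> j \<Longrightarrow> \<bar>N $ i $ j\<bar> \<le> \<kappa> / (4 * real CARD('n))"
    and "0 < \<kappa>"
  shows "\<kappa> / (4 * real CARD('n)) * norm x \<le> norm (N *v x)"
proof -
  let ?d = "real CARD('n)"
  obtain i where max: "\<And>j. \<bar>x $ j\<bar> \<le> \<bar>x $ i\<bar>"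
    using ex_is_arg_min_if_finite[of UNIV "\<lambda>i. - \<bar>x $ i\<bar>"]
    by (auto simp: is_arg_min_linorder)
  have "(N *v x) $ i = N $ i $ i * x $ i + (\<Sum>j\<in>UNIV - {i}. N $ i $ j * x $ j)"
    by (simp add: matrix_vector_mult_def sum.remove[of UNIV i])
  moreover have "\<bar>\<Sum>j\<in>UNIV - {i}. N $ i $ j * x $ j\<bar> \<le> (\<Sum>j\<in>UNIV - {i}. \<kappa> / (4 * ?d) * \<bar>x $ i\<bar>)"
  proof (intro order_trans[OF sum_abs] sum_mono)
    fix j assume "j \<in> UNIV - {i}"
    then show "\<bar>N $ i $ j * x $ j\<bar> \<le> \<kappa> / (4 * ?d) * \<bar>x $ i\<bar>"
      unfolding abs_mult using off[of i j] max[of j] \<open>0 < \<kappa>\<close> by (intro mult_mono) auto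
  qed
  moreover have "(\<Sum>j\<in>UNIV - {i}. \<kappa> / (4 * ?d) * \<bar>x $ i\<bar>) \<le> (\<Sum>j\<in>(UNIV::'n set). \<kappa> / (4 * ?d) * \<bar>x $ i\<bar>)"
    using \<open>0 < \<kappa>\<close> by (intro sum_mono2) auto
  moreover have "\<dots> = \<kappa> / 4 * \<bar>x $ i\<bar>"
    by simp
  moreover have "\<bar>N $ i $ i * x $ i\<bar> \<ge> \<kappa> / 2 * \<bar>x $ i\<bar>"
    unfolding abs_mult using diag[of i] by (intro mult_right_mono) auto
  ultimately have "\<kappa> / 4 * \<bar>x $ i\<bar> \<le> \<bar>(N *v x) $ i\<bar>"
    by linarith
  also have "\<dots> \<le> norm (N *v x)" by (rule component_le_norm_cart)
  finally have 1: "\<kappa> / 4 * \<bar>x $ i\<bar> \<le> norm (N *v x)" .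
  have "norm x \<le> (\<Sum>j\<in>UNIV. \<bar>x $ j\<bar>)" by (rule norm_le_l1_cart)
  also have "\<dots> \<le> (\<Sum>j\<in>(UNIV::'n set). \<bar>x $ i\<bar>)" by (intro sum_mono max)
  finally have "norm x \<le> ?d * \<bar>x $ i\<bar>" by simp
  then have "\<kappa> / (4 * ?d) * norm x \<le> \<kappa> / (4 * ?d) * (?d * \<bar>x $ i\<bar>)"
    using \<open>0 < \<kappa>\<close> by (intro mult_left_mono) auto
  with 1 show ?thesis by simp
qed

lemma invertible_norm_ge:
  fixes N :: "real^'n^'n"
  assumes "0 < \<delta>" "\<And>x. \<delta> * norm x \<le> norm (N *v x)"
  shows "invertible N"
proof -
  have "x = 0" if "N *v x = 0" for x
    using assms(2)[of x] \<open>0 < \<delta>\<close> that by (simp add: mult_le_0_iff)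
  then show ?thesis
    using matrix_left_invertible_ker invertible_left_inverse by blast
qed

text \<open>\<open>R\<close> maps column \<open>j\<close> of \<open>S\<close> to a unit vector, so
  this column has norm at most 1/\<delta>.\<close>

lemma left_inverse_entry_le:
  fixes R S :: "real^'n^'n"
  assumes "0 < \<delta>" and R: "\<And>x. \<delta> * norm x \<le> norm (R *v x)" and S: "S ** R = mat 1"
  shows "\<bar>S $ i $ j\<bar> \<le> 1 / \<delta>"
proof -
  have RS: "R ** S = mat 1" using S matrix_left_right_inverse by blast
  have "\<delta> * norm (S *v axis j 1) \<le> norm (R *v (S *v axis j 1))" by (rule R)
  also have "\<dots> = 1" by (simp add: matrix_vector_mul_assoc RS)
  finally have "norm (S *v axis j 1) \<le> 1 / \<delta>"
    using \<open>0 < \<delta>\<close> by (simp add: field_simps)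
  moreover have "(S *v axis j 1) $ i = S $ i $ j"
    by (simp add: matrix_vector_mult_basis column_def)
  ultimately show ?thesis
    using component_le_norm_cart[of "S *v axis j 1" i] by simp
qed

text \<open>Only the terms with k \<ge> i contribute, and for them \<open>w k j\<close> is at most
  \<open>w i j\<close>. So a bound that decreases in the row index survives such a factor up to a
  constant; this is the purpose of the triangular decomposition.\<close>

lemma upper_triangular_mult_entry_le:
  fixes R N :: "real^'n::{finite,linorder}^'n::_" and w :: "'n \<Rightarrow> 'n \<Rightarrow> real" and L :: real
  assumes tri: "\<And>i j. j < i \<Longrightarrow> R $ i $ j = 0"
    and R: "\<And>i j. \<bar>R $ i $ j\<bar> \<le> L"
    and N: "\<And>i j. \<bar>N $ i $ j\<bar> \<le> w i j"
    and w: "\<And>i k j. i \<le> k \<Longrightarrow> w k j \<le> w i j"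
  shows "\<bar>(R ** N) $ i $ j\<bar> \<le> real CARD('n) * L * w i j"
proof -
  have "\<bar>R $ i $ k * N $ k $ j\<bar> \<le> L * w i j" for k
  proof (cases "k < i")
    case True
    then show ?thesis
      using tri R[of i k] N[of i j] by (auto intro!: mult_nonneg_nonneg)
  next
    case False
    then have "\<bar>N $ k $ j\<bar> \<le> w i j" using N[of k j] w[of i k j] by (auto simp: not_less)
    then show ?thesis
      using R[of i k] by (auto simp: abs_mult intro!: mult_mono)
  qed
  then have "\<bar>(R ** N) $ i $ j\<bar> \<le> (\<Sum>k\<in>(UNIV::'n set). L * w i j)"
    by (simp add: matrix_matrix_mult_def del: sum_constant) (intro order_trans[OF sum_abs] sum_mono)
  then show ?thesis by simp
qed

section \<open>Rotated boxes\<close>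

lemma compact_image_linear:
  fixes f :: "'a::euclidean_space \<Rightarrow> 'b::real_normed_vector"
  assumes "linear f" "compact K"
  shows "compact (f ` K)"
  using assms by (simp add: compact_continuous_image linear_continuous_on linear_conv_bounded_linear)

text \<open>Replacing coordinate \<open>i\<close> of \<open>x\<close> by
  \<open>v \<bullet> x\<close> is a linear map of determinant \<open>v $ i\<close>. It sends
  \<open>X\<close> into a box with side \<beta> in direction \<open>i\<close> and sides
  \<open>a k\<close> elsewhere; comparing volumes gives the bound.\<close>

lemma measure_slab_wellorder:
  fixes X :: "(real^'n::{finite,wellorder}) set"
  assumes X: "compact X" and a: "\<And>x k. x \<in> X \<Longrightarrow> \<bar>x $ k\<bar> \<le> a k / 2"
    and v: "\<And>x. x \<in> X \<Longrightarrow> \<bar>v \<bullet> x\<bar> \<le> \<beta> / 2" and pos: "\<And>k. 0 \<le> a k" "0 \<le> \<beta>"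
  shows "\<bar>v $ i\<bar> * measure lebesgue X \<le> \<beta> * (\<Prod>k\<in>UNIV - {i}. a k)"
proof -
  define T where "T x = (\<chi> k. if k = i then v \<bullet> x else x $ k)" for x :: "real^'n::_"
  define s where "s = (\<chi> k. if k = i then \<beta> else a k)"
  have lin: "linear T"
    by (auto intro!: linearI simp: T_def vec_eq_iff inner_add_right)
  \<comment> \<open>Row \<open>i\<close>, which is \<open>v\<close>, is written as a combination of
    the rows of the identity, the form in which Cramer's rule evaluates the determinant.\<close>
  have "matrix T = (\<chi> k. if k = i then (\<Sum>l\<in>UNIV. v $ l *s row l (mat 1)) else row k (mat 1))"
    by (auto simp: matrix_def T_def vec_eq_iff row_def mat_def axis_def inner_vec_def
        if_distrib[of "\<lambda>c. _ * c"] cong: if_cong)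
  then have det: "det (matrix T) = v $ i"
    using cramer_lemma_transpose[of i v "mat 1"] by simp
  have lm: "X \<in> lmeasurable"
    using X by (rule lmeasurable_compact)
  have sub: "T ` X \<subseteq> cbox (\<chi> k. - (s $ k / 2)) (\<chi> k. s $ k / 2)"
  proof (rule image_subsetI)
    fix x assume "x \<in> X"
    then have h: "\<bar>T x $ k\<bar> \<le> s $ k / 2" for k
      using a[of x k] v[of x] by (simp add: T_def s_def)
    have "- (s $ k / 2) \<le> T x $ k \<and> T x $ k \<le> s $ k / 2" for k
      using h[of k] by linarith
    then show "T x \<in> cbox (\<chi> k. - (s $ k / 2)) (\<chi> k. s $ k / 2)"
      by (simp add: mem_box_cart)
  qed
  have "0 \<in> cbox (\<chi> k. - (s $ k / 2)) (\<chi> k. s $ k / 2)"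
    using pos by (simp add: mem_box_cart s_def)
  then have cont: "measure lebesgue (cbox (\<chi> k. - (s $ k / 2)) (\<chi> k. s $ k / 2)) = (\<Prod>k\<in>UNIV. s $ k)"
    by (subst measure_completion, simp, subst content_cbox_cart) auto
  have "\<bar>v $ i\<bar> * measure lebesgue X = measure lebesgue (T ` X)"
    using measure_linear_image[OF lin lm] det by simp
  also have "\<dots> \<le> measure lebesgue (cbox (\<chi> k. - (s $ k / 2)) (\<chi> k. s $ k / 2))"
    using sub measurable_linear_image[OF lin lm] by (intro measure_mono_fmeasurable) auto
  also have "\<dots> = \<beta> * (\<Prod>k\<in>UNIV - {i}. a k)"
    unfolding cont by (subst prod.remove[of _ i]) (auto simp: s_def intro!: prod.cong)
  finally show ?thesis .
qed

text \<open>Transported from the wellordered case: relabelling keeps inner products and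
  volumes.\<close>

lemma measure_slab:
  fixes X :: "(real^'n::{finite,linorder}) set"
  assumes X: "compact X" and a: "\<And>x k. x \<in> X \<Longrightarrow> \<bar>x $ k\<bar> \<le> a k / 2"
    and v: "\<And>x. x \<in> X \<Longrightarrow> \<bar>v \<bullet> x\<bar> \<le> \<beta> / 2" and pos: "\<And>k. 0 \<le> a k" "0 \<le> \<beta>"
  shows "\<bar>v $ i\<bar> * measure lborel X \<le> \<beta> * (\<Prod>k\<in>UNIV - {i}. a k)"
proof -
  let ?r = "\<lambda>x::real^'n::_. \<chi> i. x $ the_index i"
  have inner_r: "?r x \<bullet> ?r y = x \<bullet> y" for x y
    using sum.reindex_bij_betw[OF bij_the_index, of "\<lambda>i. x $ i * y $ i"] by (simp add: inner_vec_def)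
  have inj: "inj ?r"
  proof (rule injI)
    fix x y assume "?r x = ?r y"
    then have "x $ the_index (Index i) = y $ the_index (Index i)" for i
      by (simp only: vec_eq_iff vec_lambda_beta)
    then show "x = y" by (simp add: vec_eq_iff)
  qed
  have cpt: "compact (?r ` X)"
    using linear_reindex X by (rule compact_image_linear)
  have "measure lborel (?r ` X) = measure (distr lborel borel ?r) (?r ` X)"
    by (simp add: distr_lborel_reindex[OF bij_the_index])
  also have "\<dots> = measure lborel X"
    using borel_compact[OF cpt] inj
    by (subst measure_distr) (simp_all add: borel_measurable_linear[OF linear_reindex] inj_vimage_image_eq)
  finally have meas: "measure lborel X = measure lebesgue (?r ` X)"
    using borel_compact[OF cpt] by simp
  have "\<bar>?r v $ Index i\<bar> * measure lebesgue (?r ` X) \<le> \<beta> * (\<Prod>k\<in>UNIV - {Index i}. a (the_index k))"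
  proof (rule measure_slab_wellorder[OF cpt])
    show "\<bar>x $ k\<bar> \<le> a (the_index k) / 2" if "x \<in> ?r ` X" for x k
      using that a by auto
    show "\<bar>?r v \<bullet> x\<bar> \<le> \<beta> / 2" if "x \<in> ?r ` X" for x
      using that v by (auto simp: inner_r simp del: vec_lambda_beta)
  qed (use pos in auto)
  also have "(\<Prod>k\<in>UNIV - {Index i}. a (the_index k)) = (\<Prod>k\<in>UNIV - {i}. a k)"
    by (rule prod.reindex_bij_witness[of _ Index the_index]) auto
  finally show ?thesis by (simp add: meas)
qed

section \<open>Entry bounds and the volume of the intersection\<close>

lemma box_of_eq_cbox: "box_of s = cbox (\<chi> i. - (s $ i) / 2) (\<chi> i. s $ i / 2)"
  by (simp add: box_of_def mem_box_cart set_eq_iff)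

lemma mem_box_of: "x \<in> box_of s \<longleftrightarrow> (\<forall>i. \<bar>x $ i\<bar> \<le> s $ i / 2)"
  unfolding box_of_def mem_Collect_eq by (intro iff_allI) linarith

lemma compact_box_of: "compact (box_of s)"
  by (simp add: box_of_eq_cbox)

lemma measure_box_of:
  assumes "\<And>i. 0 \<le> s $ i"
  shows "measure lborel (box_of s) = tuple_vol s"
proof -
  have "0 \<in> box_of s" using assms by (simp add: box_of_def)
  then show ?thesis
    unfolding box_of_eq_cbox tuple_vol_def
    by (subst content_cbox_cart) auto
qed

lemma measure_vimage_orthogonal_matrix:
  fixes g :: "real^'n::{finite,linorder}^'n::_"
  assumes "orthogonal_matrix g" "Y \<in> sets borel"
  shows "measure lborel ((\<lambda>x. g *v x) -` Y) = measure lborel Y"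
proof -
  have "orthogonal_transformation (\<lambda>x. g *v x)"
    using assms by (simp add: orthogonal_transformation_matrix)
  then have "distr lborel borel (\<lambda>x. g *v x) = lborel"
    by (rule distr_lborel_orthogonal_transformation)
  moreover have "measure (distr lborel borel (\<lambda>x. g *v x)) Y = measure lborel ((\<lambda>x. g *v x) -` Y)"
    using assms(2) borel_measurable_linear[OF matrix_vector_mul_linear, of g]
    by (subst measure_distr) simp_all
  ultimately show ?thesis by simp
qed

lemma inj_orthogonal_matrix:
  fixes g :: "real^'n^'n"
  assumes "orthogonal_matrix g"
  shows "inj (\<lambda>x. g *v x)"
  using assms orthogonal_transformation_inj[of "\<lambda>x. g *v x"]
  by (simp add: orthogonal_transformation_matrix)

lemma compact_image_box_of: "compact ((\<lambda>x. g *v x) ` box_of a \<inter> box_of b)"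
  by (intro compact_Int compact_box_of compact_image_linear matrix_vector_mul_linear)

text \<open>The pullback of the intersection under \<open>g\<close> lies in \<open>box_of a\<close>
  and in the slab cut out by row \<open>j\<close> of \<open>g\<close>. \<open>measure_slab\<close>
  limits its volume; cancelling the sides other than \<open>a $ i\<close> leaves the entry
  bound.\<close>

lemma large_intersection_imp_entry_le:
  fixes g :: "real^'n::{finite,linorder}^'n::_"
  assumes g: "orthogonal_matrix g" and a: "\<And>i. 0 < a $ i" and b: "\<And>i. 0 < b $ i" and c: "0 < c"
    and large: "c * tuple_vol a \<le> measure lebesgue ((\<lambda>x. g *v x) ` box_of a \<inter> box_of b)"
  shows "\<bar>g $ j $ i\<bar> \<le> 1 / c * (b $ j / a $ i)"
proof -
  let ?Y = "(\<lambda>x. g *v x) ` box_of a \<inter> box_of b"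
  let ?X = "(\<lambda>x. g *v x) -` ?Y"
  have Y: "?Y \<in> sets borel"
    using compact_image_box_of by (rule borel_compact)
  have X_eq: "?X = box_of a \<inter> (\<lambda>x. g *v x) -` box_of b"
    using inj_orthogonal_matrix[OF g] by (auto dest: injD)
  have "closed ((\<lambda>x. g *v x) -` box_of b)"
    by (intro continuous_closed_vimage compact_imp_closed compact_box_of)
       (simp add: linear_continuous_at matrix_vector_mul_bounded_linear)
  then have X: "compact ?X"
    unfolding X_eq by (intro compact_Int_closed compact_box_of)
  have "\<bar>g $ j $ i\<bar> * measure lborel ?X \<le> b $ j * (\<Prod>k\<in>UNIV - {i}. a $ k)"
  proof (rule measure_slab[OF X])
    show "\<bar>x $ k\<bar> \<le> a $ k / 2" if "x \<in> ?X" for x k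
      using that unfolding X_eq by (auto simp: mem_box_of)
    show "\<bar>g $ j \<bullet> x\<bar> \<le> b $ j / 2" if "x \<in> ?X" for x
      using that unfolding X_eq
      by (auto simp: mem_box_of matrix_vector_mul_component)
  qed (use a b less_imp_le in auto)
  moreover have "measure lborel ?X = measure lebesgue ?Y"
    using measure_vimage_orthogonal_matrix[OF g Y] Y by simp
  moreover have "\<bar>g $ j $ i\<bar> * (c * tuple_vol a) \<le> \<bar>g $ j $ i\<bar> * measure lebesgue ?Y"
    using large by (rule mult_left_mono) simp
  moreover have "tuple_vol a = a $ i * (\<Prod>k\<in>UNIV - {i}. a $ k)"
    unfolding tuple_vol_def by (rule prod.remove) auto
  ultimately have "(\<bar>g $ j $ i\<bar> * c * a $ i) * (\<Prod>k\<in>UNIV - {i}. a $ k) \<le> b $ j * (\<Prod>k\<in>UNIV - {i}. a $ k)"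
    by (simp add: mult_ac)
  moreover have "(\<Prod>k\<in>UNIV - {i}. a $ k) > 0"
    using a by (intro prod_pos) auto
  ultimately have "\<bar>g $ j $ i\<bar> * c * a $ i \<le> b $ j"
    by (rule mult_right_le_imp_le)
  then show ?thesis
    using a[of i] c by (simp add: field_simps)
qed

text \<open>After \<open>box_of a\<close> is shrunk by \<epsilon>, each term of coordinate
  \<open>j\<close> of the image is at most \<open>A * \<epsilon> * b $ j / 2\<close>, so the image
  stays in \<open>box_of b\<close>. Rotation keeps the volume of the shrunken box.\<close>

lemma entry_le_imp_large_intersection:
  fixes g :: "real^'n::{finite,linorder}^'n::_" and A \<epsilon> :: real
  assumes g: "orthogonal_matrix g" and a: "\<And>i. 0 < a $ i" and b: "\<And>i. 0 < b $ i"
    and \<epsilon>: "0 < \<epsilon>" "\<epsilon> \<le> 1" "real CARD('n) * A * \<epsilon> \<le> 1"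
    and le: "\<And>j i. \<bar>g $ j $ i\<bar> \<le> A * (b $ j / a $ i)"
  shows "\<epsilon> ^ CARD('n) * tuple_vol a \<le> measure lebesgue ((\<lambda>x. g *v x) ` box_of a \<inter> box_of b)"
proof -
  let ?Y = "(\<lambda>x. g *v x) ` box_of a \<inter> box_of b" and ?E = "(\<lambda>x. g *v x) ` box_of (\<epsilon> *\<^sub>R a)"
  have E: "compact ?E"
    by (intro compact_box_of compact_image_linear matrix_vector_mul_linear)
  have "g *v x \<in> ?Y" if x: "x \<in> box_of (\<epsilon> *\<^sub>R a)" for x
  proof
    have xi: "\<bar>x $ i\<bar> \<le> \<epsilon> * a $ i / 2" for i
      using x by (auto simp: mem_box_of)
    have "\<epsilon> * a $ i / 2 \<le> a $ i / 2" for i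
      using \<epsilon> a[of i] by simp
    then have "\<bar>x $ i\<bar> \<le> a $ i / 2" for i
      using xi order_trans by blast
    then have "x \<in> box_of a"
      by (auto simp: mem_box_of)
    then show "g *v x \<in> (\<lambda>x. g *v x) ` box_of a" by blast
    have "\<bar>(g *v x) $ j\<bar> \<le> b $ j / 2" for j
    proof -
      have "\<bar>g $ j $ i * x $ i\<bar> \<le> A * \<epsilon> * b $ j / 2" for i
      proof -
        have "\<bar>g $ j $ i * x $ i\<bar> \<le> (A * (b $ j / a $ i)) * (\<epsilon> * a $ i / 2)"
          unfolding abs_mult using le[of j i] xi[of i] by (intro mult_mono) auto
        also have "\<dots> = A * \<epsilon> * b $ j / 2" using a[of i] by simp
        finally show ?thesis .
      qed
      then have "\<bar>(g *v x) $ j\<bar> \<le> (\<Sum>i\<in>(UNIV::'n set). A * \<epsilon> * b $ j / 2)"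
        unfolding matrix_vector_mult_def vec_lambda_beta
        by (intro order_trans[OF sum_abs] sum_mono)
      also have "\<dots> = (CARD('n) * A * \<epsilon>) * (b $ j / 2)" by simp
      also have "\<dots> \<le> 1 * (b $ j / 2)"
        using \<epsilon>(3) less_imp_le[OF b[of j]] by (intro mult_right_mono) simp_all
      finally show ?thesis by simp
    qed
    then show "g *v x \<in> box_of b"
      by (auto simp: mem_box_of)
  qed
  then have sub: "?E \<subseteq> ?Y" by blast
  have "\<epsilon> ^ CARD('n) * tuple_vol a = tuple_vol (\<epsilon> *\<^sub>R a)"
    by (simp add: tuple_vol_def prod.distrib)
  also have "\<dots> = measure lborel (box_of (\<epsilon> *\<^sub>R a))"
    using \<epsilon> a by (subst measure_box_of) (auto intro: less_imp_le)
  also have "\<dots> = measure lborel ?E"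
    using measure_vimage_orthogonal_matrix[OF g borel_compact[OF E]]
    by (simp add: inj_vimage_image_eq[OF inj_orthogonal_matrix[OF g]])
  also have "\<dots> = measure lebesgue ?E"
    using borel_compact[OF E] by simp
  also have "\<dots> \<le> measure lebesgue ?Y"
    using sub lmeasurable_compact[OF E] lmeasurable_compact[OF compact_image_box_of]
    by (intro measure_mono_fmeasurable) auto
  finally show ?thesis .
qed

section \<open>Measurability of the intersection volume\<close>

lemma closed_matrix_image_graph:
  fixes K :: "(real^'n) set"
  assumes K: "compact K"
  shows "closed {(g :: real^'n^'m, y). y \<in> (\<lambda>x. g *v x) ` K}"
  unfolding closed_sequential_limits
proof (intro allI impI, elim conjE)
  fix z :: "nat \<Rightarrow> (real^'n^'m) \<times> (real^'m)" and l
  assume z: "\<forall>n. z n \<in> {(g, y). y \<in> (\<lambda>x. g *v x) ` K}" and l: "z \<longlonglongrightarrow> l"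
  have "\<forall>n. \<exists>x\<in>K. snd (z n) = fst (z n) *v x"
    using z by (auto simp: case_prod_beta)
  then obtain x where x: "\<And>n. x n \<in> K" "\<And>n. snd (z n) = fst (z n) *v x n" by metis
  \<comment> \<open>Compactness of \<open>K\<close> makes the preimages converge along a
    subsequence, and the relation between matrix, preimage and image passes to the limit.\<close>
  obtain x0 r where r: "x0 \<in> K" "strict_mono r" "(x \<circ> r) \<longlonglongrightarrow> x0"
    using K x(1) unfolding compact_def by metis
  have zr: "(\<lambda>n. z (r n)) \<longlonglongrightarrow> l"
    using LIMSEQ_subseq_LIMSEQ[OF l r(2)] by (simp add: o_def)
  have "(\<lambda>n. fst (z (r n)) *v x (r n)) \<longlonglongrightarrow> fst l *v x0"
  proof (rule vec_tendstoI)
    fix i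
    have "(\<lambda>n. \<Sum>j\<in>UNIV. fst (z (r n)) $ i $ j * x (r n) $ j) \<longlonglongrightarrow> (\<Sum>j\<in>UNIV. fst l $ i $ j * x0 $ j)"
      using r(3) tendsto_fst[OF zr] unfolding o_def
      by (intro tendsto_sum tendsto_mult tendsto_vec_nth)
    then show "(\<lambda>n. (fst (z (r n)) *v x (r n)) $ i) \<longlonglongrightarrow> (fst l *v x0) $ i"
      by (simp add: matrix_vector_mult_def)
  qed
  moreover have "(\<lambda>n. fst (z (r n)) *v x (r n)) \<longlonglongrightarrow> snd l"
    using tendsto_snd[OF zr] by (simp add: x(2))
  ultimately have "snd l = fst l *v x0"
    using LIMSEQ_unique by blast
  then show "l \<in> {(g, y). y \<in> (\<lambda>x. g *v x) ` K}"
    using r(1) by (auto simp: case_prod_beta)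
qed

text \<open>The volume is that of a section of a closed, hence Borel, set of pairs. Measurability of
  the event allows it to be bounded below by monotonicity of \<mu>.\<close>

lemma borel_measurable_measure_intersection:
  "(\<lambda>g :: real^'n^'n. measure lebesgue ((\<lambda>x. g *v x) ` box_of a \<inter> box_of b)) \<in> borel_measurable borel"
proof -
  let ?D = "{(g :: real^'n^'n, y). y \<in> (\<lambda>x. g *v x) ` box_of a} \<inter> UNIV \<times> box_of b"
  have "closed ?D"
    using closed_Times[OF closed_UNIV compact_imp_closed[OF compact_box_of]]
    by (rule closed_Int[OF closed_matrix_image_graph[OF compact_box_of]])
  then have "?D \<in> sets (borel \<Otimes>\<^sub>M borel)"
    unfolding borel_prod by (rule borel_closed)
  also have "sets (borel \<Otimes>\<^sub>M borel) = sets ((borel :: (real^'n^'n) measure) \<Otimes>\<^sub>M (lborel :: (real^'n) measure))"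
    by (intro sets_pair_measure_cong) simp_all
  finally have "(\<lambda>g. enn2real (emeasure lborel (Pair g -` ?D))) \<in> borel_measurable borel"
    by (intro borel_measurable_enn2real lborel.measurable_emeasure_Pair)
  moreover have "enn2real (emeasure lborel (Pair g -` ?D)) = measure lebesgue ((\<lambda>x. g *v x) ` box_of a \<inter> box_of b)" for g
  proof -
    have "Pair g -` ?D = (\<lambda>x. g *v x) ` box_of a \<inter> box_of b" by auto
    then show ?thesis
      using borel_compact[OF compact_image_box_of[of g a b]] by (simp add: measure_def)
  qed
  ultimately show ?thesis by simp
qed

section \<open>Haar measure\<close>

lemma closed_SO: "closed (SO :: (real^'n^'n) set)"
proof -
  have "continuous_on UNIV (\<lambda>g::real^'n^'n. transpose g ** g)"
    unfolding matrix_matrix_mult_def transpose_def by (intro continuous_intros)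
  moreover have "continuous_on UNIV (\<lambda>g::real^'n^'n. det g)"
    unfolding det_def by (intro continuous_intros)
  ultimately show ?thesis
    unfolding SO_def orthogonal_matrix
    by (intro closed_Collect_conj closed_Collect_eq continuous_on_const)
qed

lemma SO_mult: "g \<in> SO \<Longrightarrow> h \<in> SO \<Longrightarrow> g ** h \<in> SO"
  by (simp add: SO_def orthogonal_matrix_mul det_mul)

lemma SO_orthogonal: "g \<in> SO \<Longrightarrow> orthogonal_matrix g"
  by (simp add: SO_def)

lemma closed_SO_entry_le: "closed {g \<in> SO. \<forall>j i. \<bar>g $ j $ i\<bar> \<le> f j i}"
  unfolding Collect_conj_eq Collect_mem_eq
  by (intro closed_Int closed_SO closed_Collect_all closed_Collect_le continuous_intros)

lemma AE_haar_in_SO: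
  assumes "haar_SO \<mu>"
  shows "AE g in \<mu>. g \<in> SO"
proof -
  interpret prob_space \<mu> using assms by (simp add: haar_SO_def)
  show ?thesis
    using assms borel_closed[OF closed_SO]
    by (subst AE_in_set_eq_1) (simp_all add: haar_SO_def measure_def)
qed

text \<open>This is the monotonicity in the row index required by
  \<open>upper_triangular_mult_entry_le\<close>; it is where the ordering of \<open>b\<close>
  enters.\<close>

lemma min_ratio_antimono:
  assumes "nonincreasing_tuple b" "j \<le> k" "0 < (x::real)"
  shows "min (b $ k / x) 1 \<le> min (b $ j / x) 1"
  using assms by (intro min.mono divide_right_mono) (auto simp: nonincreasing_tuple_def)

lemma matrix_mult_vimage_borel:
  fixes M :: "real^'n^'m" and W :: "(real^'k^'m) set"
  assumes "W \<in> sets borel"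
  shows "{g. M ** g \<in> W} \<in> sets borel"
proof -
  have "continuous_on UNIV (\<lambda>g :: real^'k^'n. M ** g)"
    unfolding matrix_matrix_mult_def by (intro continuous_intros)
  from measurable_sets[OF borel_measurable_continuous_onI[OF this] assms]
  show ?thesis by (simp add: vimage_def)
qed

lemma emeasure_haar_left_mult:
  assumes "haar_SO \<mu>" "Q \<in> SO" "X \<in> sets borel"
  shows "emeasure \<mu> {g. Q ** g \<in> X} = emeasure \<mu> X"
proof -
  have sets: "sets \<mu> = sets borel" and inv: "distr \<mu> borel (\<lambda>g. Q ** g) = \<mu>"
    using assms by (auto simp: haar_SO_def)
  have "continuous_on UNIV (\<lambda>g. Q ** g)"
    unfolding matrix_matrix_mult_def by (intro continuous_intros)
  then have "(\<lambda>g. Q ** g) \<in> \<mu> \<rightarrow>\<^sub>M borel"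
    using borel_measurable_continuous_onI by (simp add: measurable_cong_sets[OF sets refl])
  then have "emeasure (distr \<mu> borel (\<lambda>g. Q ** g)) X = emeasure \<mu> {g. Q ** g \<in> X}"
    using assms(3) sets_eq_imp_space_eq[OF sets] by (simp add: emeasure_distr vimage_def)
  then show ?thesis by (simp add: inv)
qed

text \<open>Both sides are the product measure of one set of pairs. The conditions on
  \<open>M\<close> and on \<open>g\<close> are kept inside that set, so both are at hand when a
  section is estimated.\<close>

lemma haar_lebesgue_matrix_Fubini:
  assumes \<mu>: "haar_SO (\<mu> :: (real^'n^'n) measure)" and [measurable]: "B \<in> sets borel" "W \<in> sets borel"
  shows "(\<integral>\<^sup>+M. emeasure \<mu> {g. M \<in> B \<and> g \<in> SO \<and> M ** g \<in> W} \<partial>lebesgue_matrix)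
    = (\<integral>\<^sup>+g. emeasure lebesgue_matrix {M :: real^'n^'n. M \<in> B \<and> g \<in> SO \<and> M ** g \<in> W} \<partial>\<mu>)"
proof -
  have sets: "sets \<mu> = sets borel" and "prob_space \<mu>"
    using \<mu> by (auto simp: haar_SO_def)
  interpret \<mu>: prob_space \<mu> by fact
  interpret pair_sigma_finite "lebesgue_matrix :: (real^'n^'n) measure" \<mu>
    by (intro pair_sigma_finite.intro sigma_finite_lebesgue_matrix \<mu>.sigma_finite_measure_axioms)
  let ?E = "{(M :: real^'n^'n, g). M \<in> B \<and> g \<in> SO \<and> M ** g \<in> W}"
  have "continuous_on UNIV (\<lambda>(M :: real^'n^'n, g :: real^'n^'n). M ** g)"
    unfolding matrix_matrix_mult_def case_prod_beta by (intro continuous_intros)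
  then have mult: "(\<lambda>(M :: real^'n^'n, g :: real^'n^'n). M ** g) \<in> borel_measurable borel"
    by (rule borel_measurable_continuous_onI)
  have "?E = B \<times> SO \<inter> (\<lambda>(M, g). M ** g) -` W"
    by auto
  also have "\<dots> \<in> sets borel"
    using measurable_sets[OF mult \<open>W \<in> sets borel\<close>]
    by (intro sets.Int borel_Times borel_closed[OF closed_SO]) auto
  also have "sets borel = sets ((lebesgue_matrix :: (real^'n^'n) measure) \<Otimes>\<^sub>M \<mu>)"
    unfolding borel_prod[symmetric] by (intro sets_pair_measure_cong) (simp_all add: sets)
  finally have E: "?E \<in> sets ((lebesgue_matrix :: (real^'n^'n) measure) \<Otimes>\<^sub>M \<mu>)" .
  have "(\<integral>\<^sup>+M. emeasure \<mu> (Pair M -` ?E) \<partial>lebesgue_matrix) = (\<integral>\<^sup>+g. emeasure lebesgue_matrix ((\<lambda>M. (M, g)) -` ?E) \<partial>\<mu>)"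
    using \<mu>.emeasure_pair_measure_alt[OF E] emeasure_pair_measure_alt2[OF E] by simp
  then show ?thesis by (simp add: vimage_def)
qed

section \<open>Two-sided Haar estimate for the set given by entry bounds\<close>

lemma matrix_mult_entry_le_card:
  fixes M N :: "real^'n^'n"
  assumes "\<And>i j. \<bar>M $ i $ j\<bar> \<le> 1" "\<And>i j. \<bar>N $ i $ j\<bar> \<le> 1"
  shows "\<bar>(M ** N) $ i $ j\<bar> \<le> CARD('n)"
proof -
  have "\<bar>(M ** N) $ i $ j\<bar> \<le> (\<Sum>k\<in>(UNIV::'n set). 1)"
    unfolding matrix_matrix_mult_def vec_lambda_beta
  proof (intro order_trans[OF sum_abs] sum_mono)
    fix k show "\<bar>M $ i $ k * N $ k $ j\<bar> \<le> 1"
      unfolding abs_mult using assms[of i k] assms[of k j] by (intro mult_le_one) auto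
  qed
  then show ?thesis by simp
qed

lemma abs_le_one_transpose_SO: "Q \<in> SO \<Longrightarrow> \<bar>transpose Q $ i $ j\<bar> \<le> 1"
  by (simp add: transpose_def orthogonal_matrix_entry_le SO_orthogonal)

lemma I_ab_eq: "I_ab a b = (\<Prod>j\<in>UNIV. \<Prod>i\<in>UNIV. min (b $ j / a $ i) 1)"
  unfolding I_ab_def by (rule prod.swap)

lemma prod_prod_cmult:
  fixes c :: real
  shows "(\<Prod>i\<in>(UNIV::'n::finite set). \<Prod>j\<in>(UNIV::'n set). c * f i j)
    = c ^ (CARD('n))\<^sup>2 * (\<Prod>i\<in>UNIV. \<Prod>j\<in>UNIV. f i j)"
  by (simp add: prod.distrib power2_eq_square power_mult)

text \<open>Take \<open>M = R ** Q\<close> in a fixed box \<open>B\<close> of matrices.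
  \<open>R\<close> is bounded, so \<open>Q ** g \<in> X\<close> implies
  \<open>M ** g \<in> W\<close>, and left invariance gives \<mu>(X) \<le> \<mu>{g. Mg \<in> W}.
  Integrating over \<open>B\<close> and exchanging the integrals yields \<mu>(X) |B| \<le>
  |W|.\<close>

lemma measure_haar_entry_bound_le:
  fixes a b :: "real^'n::{finite,linorder}"
  assumes \<mu>: "haar_SO \<mu>" and a: "\<And>i. 0 < a $ i" and b: "\<And>i. 0 < b $ i"
    and b_mono: "nonincreasing_tuple b" and A: "1 \<le> A"
  shows "measure \<mu> {g \<in> SO. \<forall>j i. \<bar>g $ j $ i\<bar> \<le> A * (b $ j / a $ i)}
    \<le> (8 * (real CARD('n)) ^ 3 * A) ^ (CARD('n))\<^sup>2 * I_ab a b"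
proof -
  let ?d = "real CARD('n)"
  define w where "w j i = min (b $ j / a $ i) 1" for j i
  have w_pos: "0 < w j i" for j i using a b by (simp add: w_def)
  have w_mono: "w k i \<le> w j i" if "j \<le> k" for i j k
    unfolding w_def using b_mono that a by (rule min_ratio_antimono)
  define X where "X = {g \<in> SO. \<forall>j i. \<bar>g $ j $ i\<bar> \<le> A * (b $ j / a $ i)}"
  \<comment> \<open>\<open>B\<close> consists of diagonally dominant, hence invertible, matrices
    with entries at most 1, and its volume depends on the dimension only.\<close>
  define l u :: "'n \<Rightarrow> 'n \<Rightarrow> real" where "l i j = (if i = j then 1 / 2 else - (1 / (4 * ?d)))"
    and "u i j = (if i = j then 1 else 1 / (4 * ?d))" for i j
  define B where "B = {M :: real^'n::_^'n::_. \<forall>i j. l i j \<le> M $ i $ j \<and> M $ i $ j \<le> u i j}"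
  \<comment> \<open>One factor \<open>?d\<close> bounds the entries of \<open>R\<close>; the other
    comes from the number of terms in the product \<open>R ** (Q ** g)\<close>.\<close>
  define W where "W = {N :: real^'n::_^'n::_. \<forall>i j. - (?d * ?d * (A * w i j)) \<le> N $ i $ j \<and> N $ i $ j \<le> ?d * ?d * (A * w i j)}"
  have B: "B \<in> sets borel" and W: "W \<in> sets borel"
    unfolding B_def W_def by (intro borel_closed closed_entry_bounds)+
  have d: "1 \<le> ?d" by (simp add: Suc_leI)
  have sets: "sets \<mu> = sets borel" and "prob_space \<mu>"
    using \<mu> by (auto simp: haar_SO_def)
  interpret \<mu>: prob_space \<mu> by fact
  have X: "X \<in> sets borel"
    unfolding X_def by (rule borel_closed[OF closed_SO_entry_le])
  have lu: "l i j \<le> u i j" for i j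
    by (simp add: l_def u_def)
  have emB: "emeasure lebesgue_matrix B = ennreal (\<Prod>i\<in>UNIV. \<Prod>j\<in>UNIV. u i j - l i j)"
    unfolding B_def by (rule emeasure_lebesgue_matrix_entry_bounds) (rule lu)
  have emW: "emeasure lebesgue_matrix W = ennreal ((2 * (?d * ?d * A)) ^ (CARD('n))\<^sup>2 * I_ab a b)"
  proof -
    have "emeasure lebesgue_matrix W
      = ennreal (\<Prod>i\<in>UNIV. \<Prod>j\<in>UNIV. ?d * ?d * (A * w i j) - - (?d * ?d * (A * w i j)))"
      unfolding W_def using w_pos A
      by (intro emeasure_lebesgue_matrix_entry_bounds) (simp add: less_imp_le)
    also have "(\<Prod>i\<in>(UNIV::'n set). \<Prod>j\<in>(UNIV::'n set). ?d * ?d * (A * w i j) - - (?d * ?d * (A * w i j)))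
      = (\<Prod>i\<in>(UNIV::'n set). \<Prod>j\<in>(UNIV::'n set). (2 * (?d * ?d * A)) * w i j)"
      by (intro prod.cong refl) simp
    also have "\<dots> = (2 * (?d * ?d * A)) ^ (CARD('n))\<^sup>2 * I_ab a b"
      by (simp only: prod_prod_cmult I_ab_eq w_def)
    finally show ?thesis .
  qed
  have lower: "emeasure \<mu> X * indicator B M \<le> emeasure \<mu> {g. M \<in> B \<and> g \<in> SO \<and> M ** g \<in> W}" for M
  proof (cases "M \<in> B")
    case True
    then have M: "l i j \<le> M $ i $ j \<and> M $ i $ j \<le> u i j" for i j by (simp add: B_def)
    have M1: "\<bar>M $ i $ j\<bar> \<le> 1" for i j
    proof -
      have "1 / (4 * ?d) \<le> 1" unfolding divide_le_eq_1 using d by linarith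
      moreover have "- (1 / (4 * ?d)) \<le> M $ i $ j \<and> M $ i $ j \<le> 1 / (4 * ?d)" if "i \<noteq> j"
        using M[of i j] that by (simp add: l_def u_def)
      moreover have "1 / 2 \<le> M $ i $ i \<and> M $ i $ i \<le> 1"
        using M[of i i] by (simp add: l_def u_def)
      ultimately show ?thesis by (cases "i = j") (simp, linarith)
    qed
    have "1 / (4 * ?d) * norm x \<le> norm (M *v x)" for x
    proof (rule diagonally_dominant_norm_ge)
      show "1 / 2 \<le> M $ i $ i" for i using M[of i i] by (simp add: l_def)
      show "\<bar>M $ i $ j\<bar> \<le> 1 / (4 * ?d)" if "i \<noteq> j" for i j
        using M[of i j] that by (simp only: l_def u_def if_False) linarith
    qed simp
    then have "invertible M"
      using d by (intro invertible_norm_ge[of "1 / (4 * ?d)"]) auto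
    then obtain Q R S :: "real^'n::_^'n::_" where Q: "Q \<in> SO" and MRQ: "M = R ** Q"
      and R: "\<And>i j. j < i \<Longrightarrow> R $ i $ j = 0"
      by (rule upper_triangular_orthogonal_decomposition) blast
    have "R = M ** transpose Q"
      using Q by (simp add: MRQ SO_def orthogonal_matrix_def flip: matrix_mul_assoc)
    then have R_le: "\<bar>R $ i $ j\<bar> \<le> ?d" for i j
      using matrix_mult_entry_le_card[OF M1 abs_le_one_transpose_SO[OF Q]] by simp
    have "{g. Q ** g \<in> X} \<inter> SO \<subseteq> {g. M \<in> B \<and> g \<in> SO \<and> M ** g \<in> W}"
    proof safe
      fix g assume g: "Q ** g \<in> X" "g \<in> SO"
      \<comment> \<open>The cap 1 inside \<open>w\<close> is available because entries of a rotation
        are at most 1 and \<open>A\<close> is at least 1.\<close>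
      have "\<bar>(Q ** g) $ i $ j\<bar> \<le> A * w i j" for i j
      proof -
        have "\<bar>(Q ** g) $ i $ j\<bar> \<le> 1"
          using Q g(2) by (simp add: orthogonal_matrix_entry_le SO_orthogonal SO_mult)
        then have "\<bar>(Q ** g) $ i $ j\<bar> \<le> A * 1" using A by simp
        moreover have "\<bar>(Q ** g) $ i $ j\<bar> \<le> A * (b $ i / a $ j)"
          using g(1) by (simp add: X_def)
        ultimately show ?thesis by (simp add: w_def min_def)
      qed
      then have "\<bar>(R ** (Q ** g)) $ i $ j\<bar> \<le> ?d * ?d * (A * w i j)" for i j
        using A w_mono
        by (intro upper_triangular_mult_entry_le[OF R R_le]) (auto intro!: mult_left_mono)
      then show "M ** g \<in> W"
        by (simp add: W_def MRQ matrix_mul_assoc abs_le_iff) (metis minus_le_iff)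
    qed (use True in auto)
    \<comment> \<open>Intersecting with \<open>SO\<close> loses nothing: \<open>X\<close> consists
      of rotations, and \<open>g\<close> is recovered from \<open>Q ** g\<close> by the rotation
      \<open>transpose Q\<close>.\<close>
    moreover have "emeasure \<mu> ({g. Q ** g \<in> X} \<inter> SO) = emeasure \<mu> {g. Q ** g \<in> X}"
    proof -
      have "g \<in> SO" if "Q ** g \<in> X" for g
      proof -
        have "transpose Q ** (Q ** g) = g"
          using Q by (simp add: matrix_mul_assoc SO_def orthogonal_matrix)
        moreover have "transpose Q \<in> SO"
          using Q by (simp add: SO_def orthogonal_matrix_transpose)
        ultimately show ?thesis using SO_mult[of "transpose Q" "Q ** g"] that by (simp add: X_def)
      qed
      then have "{g. Q ** g \<in> X} \<inter> SO = {g. Q ** g \<in> X}" by blast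
      then show ?thesis by simp
    qed
    moreover have "{g. M \<in> B \<and> g \<in> SO \<and> M ** g \<in> W} \<in> sets \<mu>"
    proof -
      have "SO \<inter> {g. M ** g \<in> W} \<in> sets borel"
        by (intro sets.Int borel_closed[OF closed_SO] matrix_mult_vimage_borel W)
      moreover have "SO \<inter> {g. M ** g \<in> W} = {g. M \<in> B \<and> g \<in> SO \<and> M ** g \<in> W}"
        using True by auto
      ultimately show ?thesis by (simp add: sets)
    qed
    ultimately have "emeasure \<mu> X \<le> emeasure \<mu> {g. M \<in> B \<and> g \<in> SO \<and> M ** g \<in> W}"
      using emeasure_haar_left_mult[OF \<mu> Q X] emeasure_mono[of "{g. Q ** g \<in> X} \<inter> SO" _ \<mu>] by simp
    then show ?thesis using True by simp
  qed simp
  have "emeasure \<mu> X * emeasure lebesgue_matrix B = (\<integral>\<^sup>+M. emeasure \<mu> X * indicator B M \<partial>lebesgue_matrix)"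
    using B by (simp add: nn_integral_cmult)
  also have "\<dots> \<le> (\<integral>\<^sup>+M. emeasure \<mu> {g. M \<in> B \<and> g \<in> SO \<and> M ** g \<in> W} \<partial>lebesgue_matrix)"
    by (intro nn_integral_mono lower)
  also have "\<dots> = (\<integral>\<^sup>+g. emeasure lebesgue_matrix {M. M \<in> B \<and> g \<in> SO \<and> M ** g \<in> W} \<partial>\<mu>)"
    using \<mu> B W by (rule haar_lebesgue_matrix_Fubini)
  \<comment> \<open>The condition \<open>M \<in> B\<close> is dropped, and right invariance removes
    \<open>g\<close>.\<close>
  also have "\<dots> \<le> (\<integral>\<^sup>+g. emeasure lebesgue_matrix W \<partial>\<mu>)"
  proof (rule nn_integral_mono)
    fix g
    show "emeasure lebesgue_matrix {M. M \<in> B \<and> g \<in> SO \<and> M ** g \<in> W} \<le> emeasure lebesgue_matrix W"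
    proof (cases "g \<in> SO")
      case True
      have "{M. M ** g \<in> W} \<in> sets lebesgue_matrix"
        using measurable_sets[OF borel_measurable_matrix_mult_left W] by (simp add: vimage_def)
      then have "emeasure lebesgue_matrix {M. M \<in> B \<and> g \<in> SO \<and> M ** g \<in> W} \<le> emeasure lebesgue_matrix {M. M ** g \<in> W}"
        by (intro emeasure_mono) auto
      with emeasure_lebesgue_matrix_mult_orthogonal[OF SO_orthogonal[OF True] W] show ?thesis by simp
    qed simp
  qed
  also have "\<dots> = emeasure lebesgue_matrix W"
    by (simp add: \<mu>.emeasure_space_1)
  finally have main: "measure \<mu> X * (\<Prod>i\<in>UNIV. \<Prod>j\<in>UNIV. u i j - l i j) \<le> (2 * (?d * ?d * A)) ^ (CARD('n))\<^sup>2 * I_ab a b"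
    unfolding emB emW \<mu>.emeasure_eq_measure using lu A a b
    by (simp add: prod_nonneg I_ab_eq less_imp_le flip: ennreal_mult)
  \<comment> \<open>The sides of \<open>B\<close> are 1/2 on the diagonal and
    \<open>1 / (2 * ?d)\<close> off it, all at least \<open>1 / (4 * ?d)\<close>.\<close>
  have "(1 / (4 * ?d)) ^ (CARD('n))\<^sup>2 = (\<Prod>i\<in>(UNIV::'n set). \<Prod>j\<in>(UNIV::'n set). 1 / (4 * ?d))"
    by (simp add: power2_eq_square power_mult)
  also have "\<dots> \<le> (\<Prod>i\<in>UNIV. \<Prod>j\<in>UNIV. u i j - l i j)"
  proof -
    have "1 \<le> ?d * 2" using d by linarith
    then show ?thesis
      by (intro prod_mono conjI prod_nonneg) (auto simp: u_def l_def field_simps)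
  qed
  finally have "measure \<mu> X * (1 / (4 * ?d)) ^ (CARD('n))\<^sup>2 \<le> (2 * (?d * ?d * A)) ^ (CARD('n))\<^sup>2 * I_ab a b"
    using main by (meson order_trans mult_left_mono measure_nonneg)
  then have "measure \<mu> X \<le> ((2 * (?d * ?d * A)) ^ (CARD('n))\<^sup>2 * I_ab a b) * (4 * ?d) ^ (CARD('n))\<^sup>2"
    using d by (simp add: power_divide field_simps)
  also have "\<dots> = (2 * (?d * ?d * A) * (4 * ?d)) ^ (CARD('n))\<^sup>2 * I_ab a b"
    by (simp only: power_mult_distrib mult_ac)
  also have "2 * (?d * ?d * A) * (4 * ?d) = 8 * ?d ^ 3 * A"
    by (simp add: power3_eq_cube)
  finally show ?thesis
    unfolding X_def .
qed

text \<open>Now \<open>W\<close> is a box of well-conditioned matrices. If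
  \<open>M ** g \<in> W\<close> for some rotation, then \<open>M = R ** Q\<close> with the inverse
  \<open>S\<close> of \<open>R\<close> bounded and triangular, so
  \<open>Q ** g = S ** (M ** g)\<close> lies in \<open>X\<close>. Averaging gives |W| \<le> \<mu>(X)
  |B|.\<close>

lemma measure_haar_entry_bound_ge:
  fixes a b :: "real^'n::{finite,linorder}"
  assumes \<mu>: "haar_SO \<mu>" and a: "\<And>i. 0 < a $ i" and b: "\<And>i. 0 < b $ i"
    and b_mono: "nonincreasing_tuple b"
    and \<kappa>: "0 < \<kappa>" "\<kappa> \<le> 1" "\<And>i. \<kappa> \<le> b $ i / a $ i"
  shows "(\<kappa> / (4 * (real CARD('n))\<^sup>2)) ^ (CARD('n))\<^sup>2 * I_ab a b
    \<le> measure \<mu> {g \<in> SO. \<forall>j i. \<bar>g $ j $ i\<bar> \<le> 4 * (real CARD('n))\<^sup>2 / \<kappa> * (b $ j / a $ i)}"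
proof -
  let ?d = "real CARD('n)"
  define w where "w j i = min (b $ j / a $ i) 1" for j i
  have w_pos: "0 < w j i" for j i using a b by (simp add: w_def)
  have w_mono: "w k i \<le> w j i" if "j \<le> k" for i j k
    unfolding w_def using b_mono that a by (rule min_ratio_antimono)
  \<comment> \<open>The expansion constant of \<open>diagonally_dominant_norm_ge\<close>, used also
    as its bound for off-diagonal entries.\<close>
  define \<delta> where "\<delta> = \<kappa> / (4 * ?d)"
  have d: "1 \<le> ?d" by (simp add: Suc_leI)
  have \<delta>: "0 < \<delta>" "\<delta> \<le> \<kappa> / 4" "\<delta> \<le> 1"
  proof -
    show "0 < \<delta>" using \<kappa> d by (simp add: \<delta>_def)
    show "\<delta> \<le> \<kappa> / 4" unfolding \<delta>_def using \<kappa>(1) d by (intro divide_left_mono) auto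
    then show "\<delta> \<le> 1" using \<kappa> by linarith
  qed
  \<comment> \<open>\<open>1 / \<delta>\<close> bounds the entries of \<open>S\<close>, and a factor
    \<open>?d\<close> counts the terms of the product with \<open>S\<close>.\<close>
  define A where "A = 4 * ?d\<^sup>2 / \<kappa>"
  have A_eq: "A = ?d * (1 / \<delta>)"
    using \<kappa>(1) by (simp add: A_def \<delta>_def power2_eq_square)
  define X where "X = {g \<in> SO. \<forall>j i. \<bar>g $ j $ i\<bar> \<le> A * (b $ j / a $ i)}"
  \<comment> \<open>Diagonal entries are bounded away from 0, yet at most \<kappa> \<le>
    \<open>w i i\<close>, so the whole of \<open>W\<close> still obeys the bound
    \<open>w\<close>.\<close>
  define l u :: "'n \<Rightarrow> 'n \<Rightarrow> real" where "l i j = (if i = j then \<kappa> / 2 else - (\<delta> * w i j))"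
    and "u i j = (if i = j then \<kappa> else \<delta> * w i j)" for i j
  \<comment> \<open>Matrices in \<open>W\<close> have entries at most 1, so undoing a rotation gives
    entries at most \<open>?d\<close>: \<open>B\<close> catches every \<open>M\<close> with
    \<open>M ** g \<in> W\<close>.\<close>
  define B where "B = {M :: real^'n::_^'n::_. \<forall>i j. - ?d \<le> M $ i $ j \<and> M $ i $ j \<le> ?d}"
  define W where "W = {N :: real^'n::_^'n::_. \<forall>i j. l i j \<le> N $ i $ j \<and> N $ i $ j \<le> u i j}"
  have B: "B \<in> sets borel" and W: "W \<in> sets borel"
    unfolding B_def W_def by (intro borel_closed closed_entry_bounds)+
  have sets: "sets \<mu> = sets borel" and "prob_space \<mu>"
    using \<mu> by (auto simp: haar_SO_def)
  interpret \<mu>: prob_space \<mu> by fact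
  have X: "X \<in> sets borel"
    unfolding X_def by (rule borel_closed[OF closed_SO_entry_le])
  have lu: "l i j \<le> u i j" for i j
    using \<kappa> \<delta> w_pos[of i j] by (simp add: l_def u_def)
  have \<delta>w: "\<delta> * w i j \<le> \<delta>" for i j
    using \<delta> by (simp add: w_def)
  have W_diag: "\<kappa> / 2 \<le> N $ i $ i" if "N \<in> W" for N i
  proof -
    have "l i i \<le> N $ i $ i" using that unfolding W_def by blast
    then show ?thesis by (simp add: l_def)
  qed
  have W_off: "\<bar>N $ i $ j\<bar> \<le> \<delta>" if "N \<in> W" "i \<noteq> j" for N i j
  proof -
    have "l i j \<le> N $ i $ j \<and> N $ i $ j \<le> u i j" using that unfolding W_def by blast
    then show ?thesis using that(2) \<delta>w[of i j] by (simp add: l_def u_def abs_le_iff)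
  qed
  have W_le_w: "\<bar>N $ i $ j\<bar> \<le> w i j" if "N \<in> W" for N i j
  proof -
    have N: "l i j \<le> N $ i $ j \<and> N $ i $ j \<le> u i j" using that unfolding W_def by blast
    show ?thesis
    proof (cases "i = j")
      case True
      moreover have "\<kappa> \<le> w i i" using \<kappa> by (simp add: w_def)
      ultimately show ?thesis using N \<kappa>(1) by (simp add: l_def u_def abs_le_iff)
    next
      case False
      moreover have "\<delta> * w i j \<le> w i j" using \<delta> w_pos[of i j] by simp
      ultimately show ?thesis using N by (simp add: l_def u_def abs_le_iff)
    qed
  qed
  have W_le_1: "\<bar>N $ i $ j\<bar> \<le> 1" if "N \<in> W" for N i j
    using W_le_w[OF that, of i j] by (simp add: w_def)
  have W_norm: "\<delta> * norm x \<le> norm (N *v x)" if "N \<in> W" for N x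
    unfolding \<delta>_def
    by (rule diagonally_dominant_norm_ge) (use W_diag[OF that] W_off[OF that] \<kappa> in \<open>auto simp: \<delta>_def\<close>)
  have emB: "emeasure lebesgue_matrix B = ennreal ((2 * ?d) ^ (CARD('n))\<^sup>2)"
  proof -
    have "emeasure lebesgue_matrix B = ennreal (\<Prod>i\<in>(UNIV::'n set). \<Prod>j\<in>(UNIV::'n set). ?d - - ?d)"
      unfolding B_def by (rule emeasure_lebesgue_matrix_entry_bounds) simp
    also have "(\<Prod>i\<in>(UNIV::'n set). \<Prod>j\<in>(UNIV::'n set). ?d - - ?d) = (2 * ?d) ^ (CARD('n))\<^sup>2"
      using prod_prod_cmult[where c = "2 * ?d" and f = "\<lambda>_ _::'n. 1"] by simp
    finally show ?thesis .
  qed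
  have emW: "emeasure lebesgue_matrix W \<ge> ennreal ((2 * \<delta>) ^ (CARD('n))\<^sup>2 * I_ab a b)"
  proof -
    have "(2 * \<delta>) ^ (CARD('n))\<^sup>2 * I_ab a b = (\<Prod>i\<in>UNIV. \<Prod>j\<in>UNIV. 2 * \<delta> * w i j)"
      by (simp only: prod_prod_cmult I_ab_eq w_def)
    \<comment> \<open>Equality holds off the diagonal; on it the side \<kappa>/2 is at least
      2\<delta>, because \<delta> \<le> \<kappa>/4 and \<open>w i i\<close> is at most 1.\<close>
    also have "\<dots> \<le> (\<Prod>i\<in>UNIV. \<Prod>j\<in>UNIV. u i j - l i j)"
    proof (intro prod_mono conjI prod_nonneg)
      fix i j
      show "2 * \<delta> * w i j \<le> u i j - l i j"
        using \<delta>w[of i j] \<delta> unfolding u_def l_def by (auto simp only: split: if_split)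
    qed (use \<delta> w_pos in \<open>auto intro: less_imp_le\<close>)
    also have "ennreal \<dots> = emeasure lebesgue_matrix W"
      unfolding W_def by (rule emeasure_lebesgue_matrix_entry_bounds[symmetric]) (rule lu)
    finally show ?thesis by (simp add: ennreal_leI)
  qed
  have upper: "emeasure \<mu> {g. M \<in> B \<and> g \<in> SO \<and> M ** g \<in> W} \<le> emeasure \<mu> X * indicator B M" for M
  proof (cases "\<exists>g. M \<in> B \<and> g \<in> SO \<and> M ** g \<in> W")
    case True
    then obtain g0 where "M \<in> B" and g0: "g0 \<in> SO" "M ** g0 \<in> W" by blast
    \<comment> \<open>The single rotation \<open>g0\<close> suffices: \<open>M\<close> is
      \<open>M ** g0\<close> followed on the right by the isometry
      \<open>transpose g0\<close>.\<close>
    have M: "\<delta> * norm x \<le> norm (M *v x)" for x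
    proof -
      have "\<delta> * norm (transpose g0 *v x) \<le> norm ((M ** g0) *v (transpose g0 *v x))"
        by (rule W_norm[OF g0(2)])
      moreover have "(M ** g0) *v (transpose g0 *v x) = M *v x"
        using g0(1) by (simp add: matrix_vector_mul_assoc SO_def orthogonal_matrix_def
            del: transpose_matrix_vector flip: matrix_mul_assoc)
      moreover have "norm (transpose g0 *v x) = norm x"
        using g0(1) by (intro norm_orthogonal_matrix_vector_mult) (simp add: SO_def orthogonal_matrix_transpose)
      ultimately show ?thesis by simp
    qed
    then have "invertible M"
      using \<delta>(1) by (rule invertible_norm_ge[rotated])
    then obtain Q R S :: "real^'n::_^'n::_" where Q: "Q \<in> SO" and MRQ: "M = R ** Q" and SR: "S ** R = mat 1"
      and S: "\<And>i j. j < i \<Longrightarrow> S $ i $ j = 0"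
      by (rule upper_triangular_orthogonal_decomposition) blast
    have "R = M ** transpose Q"
      using Q by (simp add: MRQ SO_def orthogonal_matrix_def flip: matrix_mul_assoc)
    then have "\<delta> * norm x \<le> norm (R *v x)" for x
      using M[of "transpose Q *v x"] norm_orthogonal_matrix_vector_mult[of "transpose Q" x] Q
      by (simp add: matrix_vector_mul_assoc SO_def orthogonal_matrix_transpose del: transpose_matrix_vector)
    then have S_le: "\<bar>S $ i $ j\<bar> \<le> 1 / \<delta>" for i j
      by (intro left_inverse_entry_le[OF \<delta>(1) _ SR])
    have "{g. M \<in> B \<and> g \<in> SO \<and> M ** g \<in> W} \<subseteq> {g. Q ** g \<in> X}"
    proof safe
      fix g assume g: "g \<in> SO" "M ** g \<in> W"
      have "Q ** g = S ** (M ** g)"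
        by (simp add: MRQ matrix_mul_assoc SR)
      then have "\<bar>(Q ** g) $ j $ i\<bar> \<le> ?d * (1 / \<delta>) * w j i" for j i
        using upper_triangular_mult_entry_le[OF S S_le W_le_w[OF g(2)] w_mono] by simp
      moreover have "?d * (1 / \<delta>) * w j i \<le> A * (b $ j / a $ i)" for j i
        unfolding A_eq using \<delta>(1) by (intro mult_left_mono) (auto simp: w_def)
      ultimately show "Q ** g \<in> X"
        using Q g(1) order_trans by (fastforce simp: X_def SO_mult)
    qed
    moreover have "{g. Q ** g \<in> X} \<in> sets \<mu>"
      unfolding sets using X by (rule matrix_mult_vimage_borel)
    ultimately have "emeasure \<mu> {g. M \<in> B \<and> g \<in> SO \<and> M ** g \<in> W} \<le> emeasure \<mu> {g. Q ** g \<in> X}"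
      by (rule emeasure_mono)
    then show ?thesis
      using emeasure_haar_left_mult[OF \<mu> Q X] \<open>M \<in> B\<close> by simp
  next
    case False
    then have "{g. M \<in> B \<and> g \<in> SO \<and> M ** g \<in> W} = {}" by blast
    then show ?thesis by (simp only: emeasure_empty) simp
  qed
  have "emeasure lebesgue_matrix W = (\<integral>\<^sup>+g. emeasure lebesgue_matrix W \<partial>\<mu>)"
    by (simp add: \<mu>.emeasure_space_1)
  also have "\<dots> = (\<integral>\<^sup>+g. emeasure lebesgue_matrix {M. M \<in> B \<and> g \<in> SO \<and> M ** g \<in> W} \<partial>\<mu>)"
    using AE_haar_in_SO[OF \<mu>]
  proof (intro nn_integral_cong_AE, eventually_elim)
    fix g :: "real^'n::_^'n::_" assume g: "g \<in> SO"
    have "M \<in> B" if "M ** g \<in> W" for M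
    proof -
      have "M = (M ** g) ** transpose g"
        using g by (simp add: SO_def orthogonal_matrix_def flip: matrix_mul_assoc)
      then have "\<bar>M $ i $ j\<bar> \<le> ?d" for i j
        using matrix_mult_entry_le_card[OF W_le_1[OF that] abs_le_one_transpose_SO[OF g], of i j] by simp
      then show ?thesis by (simp add: B_def abs_le_iff) (metis minus_le_iff)
    qed
    then have "{M. M \<in> B \<and> g \<in> SO \<and> M ** g \<in> W} = {M. M ** g \<in> W}"
      using g by blast
    then show "emeasure lebesgue_matrix W = emeasure lebesgue_matrix {M. M \<in> B \<and> g \<in> SO \<and> M ** g \<in> W}"
      using emeasure_lebesgue_matrix_mult_orthogonal[OF SO_orthogonal[OF g] W] by simp
  qed
  also have "\<dots> = (\<integral>\<^sup>+M. emeasure \<mu> {g. M \<in> B \<and> g \<in> SO \<and> M ** g \<in> W} \<partial>lebesgue_matrix)"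
    using \<mu> B W by (rule haar_lebesgue_matrix_Fubini[symmetric])
  also have "\<dots> \<le> (\<integral>\<^sup>+M. emeasure \<mu> X * indicator B M \<partial>lebesgue_matrix)"
    by (intro nn_integral_mono upper)
  also have "\<dots> = emeasure \<mu> X * emeasure lebesgue_matrix B"
    using B by (simp add: nn_integral_cmult)
  finally have "ennreal ((2 * \<delta>) ^ (CARD('n))\<^sup>2 * I_ab a b) \<le> emeasure \<mu> X * emeasure lebesgue_matrix B"
    using emW by (rule order_trans[rotated])
  then have "(2 * \<delta>) ^ (CARD('n))\<^sup>2 * I_ab a b \<le> measure \<mu> X * (2 * ?d) ^ (CARD('n))\<^sup>2"
    unfolding emB \<mu>.emeasure_eq_measure by (simp flip: ennreal_mult)
  moreover have "(2 * ?d) ^ (CARD('n))\<^sup>2 > 0" by simp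
  ultimately have bound: "(2 * \<delta>) ^ (CARD('n))\<^sup>2 / (2 * ?d) ^ (CARD('n))\<^sup>2 * I_ab a b \<le> measure \<mu> X"
    by (simp add: pos_divide_le_eq)
  have "2 * \<delta> / (2 * ?d) = \<kappa> / (4 * ?d\<^sup>2)"
    by (simp add: \<delta>_def power2_eq_square)
  then have "(2 * \<delta>) ^ (CARD('n))\<^sup>2 / (2 * ?d) ^ (CARD('n))\<^sup>2 = (\<kappa> / (4 * ?d\<^sup>2)) ^ (CARD('n))\<^sup>2"
    by (simp only: power_divide[symmetric])
  with bound show ?thesis
    by (simp only: X_def A_def)
qed

section \<open>Choice of constants and conclusion\<close>

lemma dyadic_pos: "dyadic x \<Longrightarrow> 0 < x"
  by (auto simp: dyadic_def)

lemma I_ab_nonneg: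
  assumes "\<And>i. 0 < a $ i" "\<And>i. 0 < b $ i"
  shows "0 \<le> I_ab a b"
  using assms by (auto simp: I_ab_def less_imp_le intro!: prod_nonneg)

theorem lemma4p1:
  fixes C :: real
  assumes "C > 0"
  shows "\<exists>c>0. \<exists>K>0. \<forall>(\<mu>::((real, 'n) vec, 'n) vec measure) (a::(real, 'n::{finite,linorder}) vec) b.
           haar_SO \<mu> \<and> dyadic_tuple a \<and> dyadic_tuple b \<and>
           nonincreasing_tuple a \<and> nonincreasing_tuple b \<and> (\<forall>i. a $ i \<le> C * b $ i)
           \<longrightarrow> (let P = measure \<mu> {g \<in> space \<mu>.
                      c * tuple_vol a \<le> measure lebesgue ((\<lambda>x. g *v x) ` box_of a \<inter> box_of b)}
                in I_ab a b / K \<le> P \<and> P \<le> K * I_ab a b)"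
proof -
  let ?d = "real CARD('n)"
  \<comment> \<open>The hypothesis on \<open>a\<close> and \<open>b\<close> bounds each ratio
    \<open>b $ i / a $ i\<close> below by \<open>1 / C\<close>. \<open>A\<close> is then the
    constant of \<open>measure_haar_entry_bound_ge\<close>.\<close>
  define \<kappa> where "\<kappa> = min 1 (1 / C)"
  define A where "A = 4 * ?d\<^sup>2 / \<kappa>"
  \<comment> \<open>Chosen so that \<open>?d * A * \<epsilon> = 1\<close>; \<open>c\<close> is the
    fraction of the volume of \<open>box_of a\<close> kept after shrinking by \<epsilon>.\<close>
  define \<epsilon> where "\<epsilon> = 1 / (?d * A)"
  define c where "c = \<epsilon> ^ CARD('n)"
  define U where "U = (8 * ?d ^ 3 * (1 / c)) ^ (CARD('n))\<^sup>2"
  define L where "L = (\<kappa> / (4 * ?d\<^sup>2)) ^ (CARD('n))\<^sup>2"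
  have d: "1 \<le> ?d" by (simp add: Suc_leI)
  have \<kappa>: "0 < \<kappa>" "\<kappa> \<le> 1" using assms by (auto simp: \<kappa>_def)
  have A: "1 \<le> A"
  proof -
    have "1 \<le> ?d\<^sup>2" using d by (rule one_le_power)
    then have "\<kappa> \<le> 4 * ?d\<^sup>2" using \<kappa> by linarith
    then show ?thesis using \<kappa> by (simp add: A_def)
  qed
  have dA: "1 \<le> ?d * A"
    using mult_mono[OF d A] by simp
  have \<epsilon>: "0 < \<epsilon>" "\<epsilon> \<le> 1" "?d * A * \<epsilon> \<le> 1"
    using dA A by (simp_all add: \<epsilon>_def)
  have c: "0 < c" "1 \<le> 1 / c"
    using \<epsilon> by (simp_all add: c_def power_le_one)
  have L: "0 < L" using \<kappa> by (simp add: L_def)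
  show ?thesis
  proof (rule exI[of _ c], rule conjI[OF c(1)], rule exI[of _ "max U (1 / L)"], intro conjI allI impI)
    show "0 < max U (1 / L)" using L by (simp add: less_max_iff_disj)
    fix \<mu> :: "(real^'n::_^'n::_) measure" and a b :: "real^'n::_"
    assume asm: "haar_SO \<mu> \<and> dyadic_tuple a \<and> dyadic_tuple b \<and>
      nonincreasing_tuple a \<and> nonincreasing_tuple b \<and> (\<forall>i. a $ i \<le> C * b $ i)"
    then have \<mu>: "haar_SO \<mu>" and a: "\<And>i. 0 < a $ i" and b: "\<And>i. 0 < b $ i"
      and b_mono: "nonincreasing_tuple b" and ab: "\<And>i. a $ i \<le> C * b $ i"
      by (auto simp: dyadic_tuple_def dyadic_pos)
    have sets: "sets \<mu> = sets borel" and "prob_space \<mu>"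
      using \<mu> by (auto simp: haar_SO_def)
    then have space: "space \<mu> = UNIV"
      using sets_eq_imp_space_eq by fastforce
    interpret \<mu>: prob_space \<mu> by fact
    define E where "E = {g \<in> space \<mu>. c * tuple_vol a \<le> measure lebesgue ((\<lambda>x. g *v x) ` box_of a \<inter> box_of b)}"
    \<comment> \<open>The constant is a parameter because the event lies between two such sets: it
      contains the one for \<open>A\<close> and, up to a null set, is contained in the one for
      \<open>1 / c\<close>.\<close>
    define X where "X A = {g \<in> SO. \<forall>j i. \<bar>g $ j $ i\<bar> \<le> A * (b $ j / a $ i)}" for A
    have X: "X A \<in> sets \<mu>" for A
      unfolding X_def sets by (rule borel_closed[OF closed_SO_entry_le])
    have E: "E \<in> sets \<mu>"
      using borel_measurable_le[OF borel_measurable_const borel_measurable_measure_intersection[of a b]]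
      by (simp add: E_def sets space)
    have "measure \<mu> E \<le> measure \<mu> (X (1 / c))"
    proof (rule \<mu>.finite_measure_mono_AE[OF _ X])
      show "AE g in \<mu>. g \<in> E \<longrightarrow> g \<in> X (1 / c)"
        using AE_haar_in_SO[OF \<mu>]
      proof eventually_elim
        case (elim g)
        then show ?case
          using large_intersection_imp_entry_le[OF SO_orthogonal[OF elim] a b c(1)]
          by (auto simp: E_def X_def)
      qed
    qed
    also have "\<dots> \<le> U * I_ab a b"
      unfolding X_def U_def by (rule measure_haar_entry_bound_le[OF \<mu> a b b_mono c(2)])
    also have "\<dots> \<le> max U (1 / L) * I_ab a b"
      by (intro mult_right_mono I_ab_nonneg a b) simp
    finally have upper: "measure \<mu> E \<le> max U (1 / L) * I_ab a b" .
    have "I_ab a b / max U (1 / L) \<le> I_ab a b / (1 / L)"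
      using L by (intro divide_left_mono I_ab_nonneg a b) (auto simp: less_max_iff_disj)
    also have "\<dots> = L * I_ab a b" by simp
    also have "\<dots> \<le> measure \<mu> (X A)"
      unfolding X_def A_def L_def
    proof (rule measure_haar_entry_bound_ge[OF \<mu> a b b_mono \<kappa>])
      fix i
      have "1 / C \<le> b $ i / a $ i"
        using ab[of i] a[of i] \<open>C > 0\<close> by (simp add: field_simps)
      then show "\<kappa> \<le> b $ i / a $ i" by (simp add: \<kappa>_def)
    qed
    also have "\<dots> \<le> measure \<mu> E"
    proof (rule \<mu>.finite_measure_mono[OF _ E])
      show "X A \<subseteq> E"
        using entry_le_imp_large_intersection[OF SO_orthogonal a b \<epsilon>]
        by (auto simp: X_def E_def space c_def)
    qed
    finally show "let P = measure \<mu> {g \<in> space \<mu>.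
          c * tuple_vol a \<le> measure lebesgue ((\<lambda>x. g *v x) ` box_of a \<inter> box_of b)}
        in I_ab a b / max U (1 / L) \<le> P \<and> P \<le> max U (1 / L) * I_ab a b"
      using upper by (simp add: Let_def flip: E_def)
  qed
qed

end
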